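(* Let $0<q<1$, $\sigma>0$, $0\le\gamma<2$, and assume that either $\gamma\in\{0,1\}$, or $\gamma\in(0,2)\setminus\{1\}$ and $q^{-1}(1-q)(1-q^{\gamma+1})(1-q^{\gamma+2})>1$. Then: (a) The radius of starlikeness $r^{\star}(f_{\gamma,\sigma}(z;q))$ satisfies $$\frac{\sigma^2(\gamma+3)\Gamma_{q}(\gamma+1)}{(\gamma+1)\Gamma_{q}(\gamma+3)}-\frac{2\sigma^2q^2(\gamma+5)\Gamma_{q}(\gamma+3)}{(\gamma+3)\Gamma_{q}(\gamma+5)}<\left(r^{\star}(f_{\gamma,\sigma}(z;q))\right)^{-2}<\frac{\sigma^2(\gamma+3)\Gamma_{q}(\gamma+1)}{(\gamma+1)\Gamma_{q}(\gamma+3)}.$$ (b) The radius of starlikeness $r^{\star}(g_{\gamma,\sigma}(z;q))$ satisfies $$\frac{\Gamma_{q}(\gamma+3)}{3\sigma^2\Gamma_{q}(\gamma+1)}<\left(r^{\star}(g_{\gamma,\sigma}(z;q))\right)^{2}<\frac{3\Gamma_{q}(\gamma+3)\Gamma_{q}(\gamma+5)}{\sigma^{2}\left(9\Gamma_{q}(\gamma+1)\Gamma_{q}(\gamma+5)-10q^{2}\Gamma_{q}^{2}(\gamma+3)\right)}.$$ (c) The radius of starlikeness $r^{\star}(h_{\gamma,\sigma}(z;q))$ satisfies $$\frac{\Gamma_{q}(\gamma+3)}{2\sigma^2\Gamma_{q}(\gamma+1)}<r^{\star}(h_{\gamma,\sigma}(z;q))<\frac{\Gamma_{q}(\gamma+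3)\Gamma_{q}(\gamma+5)}{\sigma^2\left(2\Gamma_{q}(\gamma+1)\Gamma_{q}(\gamma+5)-3q^2\Gamma_{q}^2(\gamma+3)\right)}.$$
   Context: For $0<q<1$, $(a;q)_\infty=\prod_{k\ge1}(1-aq^{k-1})$ and the $q$-gamma function is $\Gamma_q(z)=\frac{(q;q)_\infty}{(q^z;q)_\infty}(1-q)^{1-z}$; $\Gamma_q^2(x)$ means $(\Gamma_q(x))^2$. For $\sigma>0$ and $0\le\gamma<2$ define the entire function $$\mathscr{E}_{\gamma,\sigma}(z;q)=\sum_{n\ge0}\frac{(-1)^n\sigma^{2n}q^{n(n-1)}}{\Gamma_q(2n+\gamma+1)}z^n .$$ Normalized functions: $f_{\gamma,\sigma}(z;q)=\left(z^{\gamma+1}\Gamma_q(\gamma+1)\mathscr{E}_{\gamma,\sigma}(z^2;q)\right)^{1/(\gamma+1)}$, meaning $z\left(\Gamma_q(\gamma+1)\mathscr{E}_{\gamma,\sigma}(z^2;q)\right)^{1/(\gamma+1)}$ on the largest disk $\mathbb{D}_\delta$ ($\delta\in(0,\infty]$) in which $z\mapsto\mathscr{E}_{\gamma,\sigma}(z^2;q)$ has no zeros, where the power is the analytic branch equal to $1$ at $z=0$; $g_{\gamma,\sigma}(z;q)=z\Gamma_q(\gamma+1)\mathscr{E}_{\gamma,\sigma}(z^2;q)$; $h_{\gamma,\sigma}(z;q)=z\Gamma_q(\gamma+1)\mathscr{E}_{\gamma,\sigma}(z;q)$. Write $\mathbb{D}_r=\{z\in\mathbb{C}:|z|<r\}$.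 For a function $f$ analytic in a disk centered at $0$ with $f(0)=0$, $f'(0)=1$, the radius of starlikeness (of order $0$) is $$r^\star(f)=\sup\left\{r>0:\ \operatorname{Re}\left(\frac{zf'(z)}{f(z)}\right)>0\ \text{for all } z\in\mathbb{D}_r\right\},$$ where $r$ ranges over radii such that $\mathbb{D}_r$ lies in the domain of $f$, and $zf'(z)/f(z)$ is taken to be $1$ at $z=0$ (the condition includes that $f$ has no zeros in $\mathbb{D}_r\setminus\{0\}$). *)

theory Defs
  imports "HOL-Complex_Analysis.Complex_Analysis"
begin

definition qpochhammer_inf :: "real \<Rightarrow> real \<Rightarrow> real" where
  "qpochhammer_inf a q = (\<Prod>k. 1 - a * q ^ k)"

text \<open>
  The \<open>q\<close>-gamma function is only needed (and only defined here) for real arguments.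
\<close>

definition q_gamma :: "real \<Rightarrow> real \<Rightarrow> real" where
  "q_gamma q x = qpochhammer_inf q q / qpochhammer_inf (q powr x) q * (1 - q) powr (1 - x)"

definition qE :: "real \<Rightarrow> real \<Rightarrow> real \<Rightarrow> complex \<Rightarrow> complex" where
  "qE q \<gamma> \<sigma> z =
     (\<Sum>n. complex_of_real
            ((-1) ^ n * \<sigma> ^ (2 * n) * q ^ (n * (n - 1)) / q_gamma q (2 * real n + \<gamma> + 1)) * z ^ n)"

text \<open>
  \<open>w\<close> is the analytic branch on \<open>D\<close> of the power \<open>F\<close> to the exponent \<open>a\<close> with value \<open>1\<close> at \<open>0\<close>:
  that is, \<open>exp (a * L)\<close> for an analytic logarithm \<open>L\<close> of \<open>F\<close> with \<open>L 0 = 0\<close>.  Requiring only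
  \<open>w powr (1 / a) = F\<close> would be wrong for non-integral \<open>1 / a\<close>, since the library's \<open>powr\<close> is the
  principal power.
\<close>

definition is_power_branch ::
  "complex set \<Rightarrow> (complex \<Rightarrow> complex) \<Rightarrow> real \<Rightarrow> (complex \<Rightarrow> complex) \<Rightarrow> bool" where
  "is_power_branch D F a w \<longleftrightarrow>
     (\<exists>L. L holomorphic_on D \<and> L 0 = 0 \<and> (\<forall>z\<in>D. exp (L z) = F z) \<and>
          (\<forall>z\<in>D. w z = exp (complex_of_real a * L z)))"

text \<open>
  The following two lemmas show that the choice in \<open>power_branch\<close> is legitimate and, on \<open>D\<close>,
  unambiguous; off \<open>D\<close> the values are irrelevant.
\<close>

definition power_branch ::
  "complex set \<Rightarrow> (complex \<Rightarrow> complex) \<Rightarrow> real \<Rightarrow> complex \<Rightarrow> complex" where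
  "power_branch D F a = (SOME w. is_power_branch D F a w)"

lemma is_power_branch_power_branch:
  assumes "open D" "convex D" "0 \<in> D"
    and "F holomorphic_on D" "\<And>z. z \<in> D \<Longrightarrow> F z \<noteq> 0" "F 0 = 1"
  shows "is_power_branch D F a (power_branch D F a)"
proof -
  have "contractible D"
    using assms(2) by (rule convex_imp_contractible)
  then obtain g where g: "g holomorphic_on D" "\<And>z. z \<in> D \<Longrightarrow> F z = exp (g z)"
    using contractible_imp_holomorphic_log[OF assms(4) _ assms(5)] by metis
  define L where "L = (\<lambda>z. g z - g 0)"
  have "exp (g 0) = 1"
    using g(2)[OF assms(3)] assms(6) by simp
  then have "is_power_branch D F a (\<lambda>z. exp (complex_of_real a * L z))"
    unfolding is_power_branch_def
    by (intro exI[of _ L]) (auto simp: L_def exp_diff g(2) intro!: holomorphic_intros g(1))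
  then show ?thesis
    unfolding power_branch_def by (rule someI[of "is_power_branch D F a"])
qed

lemma is_power_branch_unique:
  assumes "open D" "convex D" "0 \<in> D"
    and "is_power_branch D F a v" "is_power_branch D F a w" "z \<in> D"
  shows "v z = w z"
proof -
  obtain L where L: "L holomorphic_on D" "L 0 = 0" "\<forall>z\<in>D. exp (L z) = F z"
      "\<forall>z\<in>D. v z = exp (complex_of_real a * L z)"
    using assms(4) unfolding is_power_branch_def by blast
  obtain M where M: "M holomorphic_on D" "M 0 = 0" "\<forall>z\<in>D. exp (M z) = F z"
      "\<forall>z\<in>D. w z = exp (complex_of_real a * M z)"
    using assms(5) unfolding is_power_branch_def by blast
  define h where "h = (\<lambda>z. (L z - M z) / (2 * of_real pi * \<i>))"
  have "h constant_on D"
  proof (rule continuous_discrete_range_constant)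
    show "connected D"
      using assms(2) by (rule convex_connected)
    show "continuous_on D h"
      unfolding h_def using L(1) M(1)
      by (intro continuous_intros) (auto intro: holomorphic_on_imp_continuous_on)
    have int: "\<exists>n::int. h z = of_int n" if "z \<in> D" for z
    proof -
      have "exp (L z) = exp (M z)"
        using that L(3) M(3) by simp
      then obtain n :: int where "L z = M z + of_int (2 * n) * pi * \<i>"
        unfolding exp_eq by blast
      then show ?thesis
        by (intro exI[of _ n]) (simp add: h_def field_simps)
    qed
    show "\<exists>e>0. \<forall>y. y \<in> D \<and> h y \<noteq> h x \<longrightarrow> e \<le> norm (h y - h x)" if x: "x \<in> D" for x
    proof (intro exI[of _ 1] conjI allI impI)
      fix y assume y: "y \<in> D \<and> h y \<noteq> h x"
      obtain m :: int where m: "h y = of_int m"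
        using int[of y] y by blast
      obtain n :: int where n: "h x = of_int n"
        using int[OF x] by blast
      note mn = m n
      have "h y - h x = of_int (m - n)"
        by (simp only: mn of_int_diff)
      then have "norm (h y - h x) = real_of_int \<bar>m - n\<bar>"
        by (simp only: norm_of_int of_int_abs)
      then show "1 \<le> norm (h y - h x)"
        using mn y by auto
    qed simp
  qed
  then have "h z = h 0"
    using assms(3,6) unfolding constant_on_def by metis
  then have "L z = M z"
    using L(2) M(2) by (simp add: h_def)
  then show ?thesis
    using L(4) M(4) assms(6) by simp
qed

definition zero_free_radius :: "real \<Rightarrow> real \<Rightarrow> real \<Rightarrow> ereal" where
  "zero_free_radius q \<gamma> \<sigma> =
     Sup {ereal r | r. 0 < r \<and> (\<forall>z\<in>ball 0 r. qE q \<gamma> \<sigma> (z\<^sup>2) \<noteq> 0)}"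

definition zero_free_disk :: "real \<Rightarrow> real \<Rightarrow> real \<Rightarrow> complex set" where
  "zero_free_disk q \<gamma> \<sigma> = eball 0 (zero_free_radius q \<gamma> \<sigma>)"

definition fE :: "real \<Rightarrow> real \<Rightarrow> real \<Rightarrow> complex \<Rightarrow> complex" where
  "fE q \<gamma> \<sigma> z =
     z * power_branch (zero_free_disk q \<gamma> \<sigma>)
           (\<lambda>w. complex_of_real (q_gamma q (\<gamma> + 1)) * qE q \<gamma> \<sigma> (w\<^sup>2)) (1 / (\<gamma> + 1)) z"

definition gE :: "real \<Rightarrow> real \<Rightarrow> real \<Rightarrow> complex \<Rightarrow> complex" where
  "gE q \<gamma> \<sigma> z = z * complex_of_real (q_gamma q (\<gamma> + 1)) * qE q \<gamma> \<sigma> (z\<^sup>2)"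

definition hE :: "real \<Rightarrow> real \<Rightarrow> real \<Rightarrow> complex \<Rightarrow> complex" where
  "hE q \<gamma> \<sigma> z = z * complex_of_real (q_gamma q (\<gamma> + 1)) * qE q \<gamma> \<sigma> z"

text \<open>
  Radius of starlikeness of \<open>f\<close> with domain \<open>D\<close>.  The supremum is taken in the extended reals, so
  it is \<open>\<infinity>\<close> when the admissible radii are unbounded and \<open>-\<infinity>\<close> when there are none.  At \<open>z = 0\<close> the
  quotient is \<open>1\<close> by convention, so nothing is required there.
\<close>

definition radius_of_starlikeness :: "complex set \<Rightarrow> (complex \<Rightarrow> complex) \<Rightarrow> ereal" where
  "radius_of_starlikeness D f =
     Sup {ereal r | r. 0 < r \<and> ball 0 r \<subseteq> D \<and>
            (\<forall>z\<in>ball 0 r - {0}. f z \<noteq> 0 \<and> Re (z * deriv f z / f z) > 0)}"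

end

(*
  F(z) = Gamma_q(gamma+1) E(z) is a locally uniform limit of polynomials P(z) = prod (1 - a_i z) with
  a_i > 0.  For gamma in {0,1} these are rescaled Wall (little q^2-Laguerre) polynomials, real-rooted by
  their three-term recurrence; otherwise the hypothesis forces q < 1/2, so the Taylor coefficients c_n
  of F satisfy c_n^2 > 4 c_(n-1) c_(n+1) and the truncations are real-rooted.
  No Hadamard factorisation of F is needed: what is used about S(z) = - z F'(z) / F(z) holds for each P
  and survives the limit, namely Re S(z) <= S(|z|) and two bounds relating x to t = S(x) through
  c1 = sum a_i and c2 = sum_(i<j) a_i a_j.  These replace the Euler-Rayleigh inequalities; they carry an
  explicit gap proportional to c2 > 0 and therefore stay strict in the limit.  The three radii are the
  solutions of S(x) = t for t = (gamma+1)/2 and t = 1/2 (with x = r^2) and t = 1 (with x = r).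
*)

theory Submission
  imports Defs "HOL-Computational_Algebra.Fundamental_Theorem_Algebra"
begin

text \<open>For each of the three functions z f'(z) / f(z) equals 1 - S(z^m) / t with m = 1 or 2, so
  starlikeness is the condition Re S < t. The bound by S(|z|) comes from the same bound for w / (1 -
  w) and moves the question to the positive axis. The bounds relating x and t are algebra in u_i =
  a_i x and b_i = u_i / (1 - u_i), whose sum is t: one rests on b_i u_i = b_i - u_i, the other on
  Cauchy-Schwarz with weights b_i. The obstacle is that nothing relates the zeros of one approximant
  to those of the next. Only symmetric quantities pass to the limit, namely the sums of a_i and
  a_i^2 and S itself, and S does so only where F > 0 on [0, x], since this keeps the zeros of late
  approximants beyond x. That the solution of S(x) = t precedes the first positive zero of F is
  shown without locating that zero: y^t F(y) increases as long as t F(y) + y F'(y) > 0.\<close>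

section \<open>Inequalities for finite products\<close>

text \<open>Write \<open>s\<^sup>2 - s2\<close> as the sum of u (s - u), enlarge the factor u to b,
  and use b u = b - u. In the application u is \<open>a N i * x\<close>, so the left side is twice
  the second elementary symmetric sum, times x^2.\<close>

lemma sum_ratio_lower:
  fixes b :: "'i \<Rightarrow> real"
  assumes fin: "finite I" and nonneg: "\<And>i. i \<in> I \<Longrightarrow> 0 \<le> b i"
  defines "t \<equiv> \<Sum>i\<in>I. b i" and "s \<equiv> \<Sum>i\<in>I. b i / (1 + b i)"
    and "s2 \<equiv> \<Sum>i\<in>I. (b i / (1 + b i))\<^sup>2"
  shows "s\<^sup>2 - s2 \<le> (1 + t) * s - t"
proof -
  define u where "u = (\<lambda>i. b i / (1 + b i))"
  have su: "s = sum u I" "s2 = (\<Sum>i\<in>I. (u i)\<^sup>2)"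
    by (auto simp: s_def s2_def u_def)
  have u: "0 \<le> u i" "u i \<le> b i" "b i * u i = b i - u i" if "i \<in> I" for i
    using nonneg[OF that] by (auto simp: u_def field_simps)
  have us: "u i \<le> s" if "i \<in> I" for i
    using member_le_sum[OF that, of u] u fin by (auto simp: s_def u_def)
  have "s\<^sup>2 - s2 = (\<Sum>i\<in>I. u i * (s - u i))"
    by (simp add: su algebra_simps sum_subtractf sum_distrib_left power2_eq_square)
  also have "\<dots> \<le> (\<Sum>i\<in>I. b i * (s - u i))"
    using u us by (intro sum_mono mult_right_mono) auto
  also have "\<dots> = (\<Sum>i\<in>I. b i * s - (b i - u i))"
    by (intro sum.cong) (auto simp: algebra_simps u(3))
  also have "\<dots> = t * s - (t - s)"
    by (simp add: sum_subtractf t_def s_def u_def sum_distrib_right)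
  finally show ?thesis by (simp add: algebra_simps)
qed

text \<open>With w the sum of b / (1 + b)^2, the difference t (t + 1) s - t (t + 2) s2 - t w equals
  t times the sum of b (t - b) / (1 + b)^2. Cauchy-Schwarz bounds t w below by s^2; the remaining
  sum is not discarded but becomes the third term on the left.\<close>

lemma sum_ratio_upper:
  fixes b :: "'i \<Rightarrow> real"
  assumes fin: "finite I" and nonneg: "\<And>i. i \<in> I \<Longrightarrow> 0 \<le> b i"
  defines "t \<equiv> \<Sum>i\<in>I. b i" and "s \<equiv> \<Sum>i\<in>I. b i / (1 + b i)"
    and "s2 \<equiv> \<Sum>i\<in>I. (b i / (1 + b i))\<^sup>2"
  assumes tpos: "0 < t"
  shows "s\<^sup>2 + t * (t + 2) * s2 + t / (1 + t)\<^sup>2 * (s\<^sup>2 - s2) \<le> t * (t + 1) * s"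
proof -
  define u where "u = (\<lambda>i. b i / (1 + b i))"
  have su: "s = sum u I" "s2 = (\<Sum>i\<in>I. (u i)\<^sup>2)"
    by (auto simp: s_def s2_def u_def)
  define w where "w = (\<Sum>i\<in>I. b i / (1 + b i)\<^sup>2)"
  have u: "0 \<le> u i" "u i \<le> b i" if "i \<in> I" for i
    using nonneg[OF that] by (auto simp: u_def field_simps)
  have bt: "b i \<le> t" if "i \<in> I" for i
    using member_le_sum[OF that, of b] nonneg fin by (auto simp: t_def)
  have us: "u i \<le> s" if "i \<in> I" for i
    using member_le_sum[OF that, of u] u fin by (auto simp: s_def u_def)
  have diff: "s - u i \<le> t - b i" if "i \<in> I" for i
  proof -
    have "s - u i = sum u (I - {i})" "t - b i = sum b (I - {i})"
      using that fin by (auto simp: s_def t_def u_def sum_diff1)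
    then show ?thesis using u by (auto intro!: sum_mono)
  qed
  \<comment> \<open>Cauchy-Schwarz, \<open>s\<^sup>2 \<le> t * w\<close>, as a sum of squares with
    weights \<open>b i\<close> of total \<open>t\<close>.\<close>
  have "0 \<le> (\<Sum>i\<in>I. b i * (t / (1 + b i) - s)\<^sup>2)"
    using nonneg by (intro sum_nonneg) auto
  also have "\<dots> = (\<Sum>i\<in>I. t\<^sup>2 * (b i / (1 + b i)\<^sup>2) - 2 * t * s * u i + s\<^sup>2 * b i)"
    by (intro sum.cong) (auto simp: u_def power2_eq_square algebra_simps)
  also have "\<dots> = t\<^sup>2 * w - 2 * t * s * s + s\<^sup>2 * t"
    by (simp add: sum.distrib sum_subtractf w_def t_def s_def u_def sum_distrib_left)
  also have "\<dots> = t * (t * w - s\<^sup>2)"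
    by (simp add: power2_eq_square algebra_simps)
  finally have cs: "s\<^sup>2 \<le> t * w"
    using tpos by (simp add: zero_le_mult_iff)
  \<comment> \<open>Replacing each \<open>1 + b i\<close> by \<open>1 + t\<close> leaves a gap
    expressed by \<open>t\<close>, \<open>s\<close> and \<open>s2\<close> alone, which have
    limits.\<close>
  have "t / (1 + t)\<^sup>2 * (s\<^sup>2 - s2) = (\<Sum>i\<in>I. t / (1 + t)\<^sup>2 * (u i * (s - u i)))"
    unfolding sum_distrib_left[symmetric]
    by (simp add: su algebra_simps sum_subtractf sum_distrib_left power2_eq_square)
  also have "\<dots> \<le> (\<Sum>i\<in>I. t * (b i * (t - b i) / (1 + b i)\<^sup>2))"
  proof (rule sum_mono)
    fix i assume i: "i \<in> I"
    have "t / (1 + t)\<^sup>2 * (u i * (s - u i)) \<le> t / (1 + t)\<^sup>2 * (b i * (t - b i))"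
      using u[OF i] diff[OF i] us[OF i] nonneg[OF i] tpos
      by (intro mult_left_mono mult_mono) auto
    also have "\<dots> \<le> t / (1 + b i)\<^sup>2 * (b i * (t - b i))"
      using bt[OF i] nonneg[OF i] tpos
      by (intro mult_right_mono divide_left_mono power_mono) auto
    finally show "t / (1 + t)\<^sup>2 * (u i * (s - u i)) \<le> t * (b i * (t - b i) / (1 + b i)\<^sup>2)"
      by simp
  qed
  also have "\<dots> = (\<Sum>i\<in>I. t * (t + 1) * u i - t * (t + 2) * (u i)\<^sup>2 - t * (b i / (1 + b i)\<^sup>2))"
  proof (intro sum.cong refl)
    fix i assume i: "i \<in> I"
    have "1 + b i \<noteq> 0" using nonneg[OF i] by auto
    then show "t * (b i * (t - b i) / (1 + b i)\<^sup>2) =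
        t * (t + 1) * u i - t * (t + 2) * (u i)\<^sup>2 - t * (b i / (1 + b i)\<^sup>2)"
      unfolding u_def power_divide by (simp add: divide_simps) algebra
  qed
  also have "\<dots> = t * (t + 1) * s - t * (t + 2) * s2 - t * w"
    by (simp add: sum_subtractf s_def s2_def w_def u_def sum_distrib_left)
  finally show ?thesis using cs by linarith
qed

text \<open>The quotient is 1 / (1 - w) - 1, and the real part of 1 / (1 - w) is at most its norm,
  hence at most 1 / (1 - |w|).\<close>

lemma Re_moebius_le:
  fixes w :: complex
  assumes "norm w < 1"
  shows "Re (w / (1 - w)) \<le> norm w / (1 - norm w)"
proof -
  have "w \<noteq> 1"
    using assms by auto
  then have "w / (1 - w) = 1 / (1 - w) - 1"
    by (simp add: field_simps)
  then have "Re (w / (1 - w)) = Re (1 / (1 - w)) - 1"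
    by simp
  also have "\<dots> \<le> norm (1 / (1 - w)) - 1"
    using complex_Re_le_cmod by (intro diff_right_mono)
  also have "\<dots> \<le> 1 / (1 - norm w) - 1"
    using assms norm_triangle_ineq2[of 1 w]
    by (auto simp: norm_divide intro!: diff_right_mono divide_left_mono mult_pos_pos)
  also have "\<dots> = norm w / (1 - norm w)"
    using assms by (simp add: field_simps)
  finally show ?thesis .
qed

section \<open>Derivatives of products of linear factors\<close>

lemma logderiv_prod_linear:
  fixes a :: "'i \<Rightarrow> complex"
  assumes "finite I" "\<And>i. i \<in> I \<Longrightarrow> a i * z \<noteq> 1"
  shows "- (z * deriv (\<lambda>z. \<Prod>i\<in>I. 1 - a i * z) z) / (\<Prod>i\<in>I. 1 - a i * z) =
         (\<Sum>i\<in>I. a i * z / (1 - a i * z))"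
proof -
  have "((\<lambda>z. \<Prod>i\<in>I. 1 - a i * z) has_field_derivative
      (\<Prod>i\<in>I. 1 - a i * z) * (\<Sum>i\<in>I. - a i / (1 - a i * z))) (at z)"
    using assms by (intro has_field_derivative_prod') (auto intro!: derivative_eq_intros)
  moreover have "(\<Prod>i\<in>I. 1 - a i * z) \<noteq> 0"
    using assms by auto
  ultimately show ?thesis
    by (simp add: DERIV_imp_deriv sum_negf)
      (simp add: sum_distrib_left mult.commute)
qed

lemma deriv_prod_linear_0:
  fixes a :: "'i \<Rightarrow> complex"
  assumes "finite I"
  shows "deriv (\<lambda>z. \<Prod>i\<in>I. 1 - a i * z) 0 = - (\<Sum>i\<in>I. a i)"
    and "(deriv ^^ 2) (\<lambda>z. \<Prod>i\<in>I. 1 - a i * z) 0 = (\<Sum>i\<in>I. a i)\<^sup>2 - (\<Sum>i\<in>I. (a i)\<^sup>2)"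
proof -
  let ?P = "\<lambda>z. \<Prod>i\<in>I. 1 - a i * z" and ?S = "\<lambda>z. \<Sum>i\<in>I. - a i / (1 - a i * z)"
  have D: "(?P has_field_derivative ?P z * ?S z) (at z)" if "\<forall>i\<in>I. 1 - a i * z \<noteq> 0" for z
    using assms that by (intro has_field_derivative_prod') (auto intro!: derivative_eq_intros)
  show 1: "deriv ?P 0 = - (\<Sum>i\<in>I. a i)"
    using DERIV_imp_deriv[OF D[of 0]] by (simp add: sum_negf)
  \<comment> \<open>The second derivative at 0 requires the formula for the first one in a
    neighbourhood of 0, where no factor vanishes.\<close>
  have "\<forall>\<^sub>F z in nhds 0. \<forall>i\<in>I. 1 - a i * z \<noteq> 0"
  proof (intro eventually_ball_finite ballI assms)
    fix i
    have "((\<lambda>z. 1 - a i * z) \<longlongrightarrow> 1 - a i * 0) (nhds 0)"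
      by (intro tendsto_intros filterlim_ident)
    then show "\<forall>\<^sub>F z in nhds 0. 1 - a i * z \<noteq> 0"
      by (rule tendsto_imp_eventually_ne) auto
  qed
  then have ev: "\<forall>\<^sub>F z in nhds 0. deriv ?P z = ?P z * ?S z"
    by eventually_elim (rule DERIV_imp_deriv[OF D])
  have "((\<lambda>z. ?P z * ?S z) has_field_derivative
      ?P 0 * ?S 0 * ?S 0 + ?P 0 * (\<Sum>i\<in>I. - (a i)\<^sup>2)) (at 0)"
    by (rule derivative_eq_intros D refl | simp add: sum_negf power2_eq_square)+
  then have "deriv (deriv ?P) 0 = ?P 0 * ?S 0 * ?S 0 + ?P 0 * (\<Sum>i\<in>I. - (a i)\<^sup>2)"
    by (simp add: deriv_cong_ev[OF ev refl] DERIV_imp_deriv)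
  then show "(deriv ^^ 2) ?P 0 = (\<Sum>i\<in>I. a i)\<^sup>2 - (\<Sum>i\<in>I. (a i)\<^sup>2)"
    by (simp add: numeral_2_eq_2 sum_negf power2_eq_square)
qed

section \<open>Limits of polynomials with positive zeros\<close>

text \<open>The \<open>a N i\<close> are the reciprocals of the zeros of the N-th approximant. Since
  \<open>R\<close> is arbitrary, convergence is locally uniform on the plane; the number
  \<open>n N\<close> of zeros is left free.\<close>

locale positive_zeros_limit =
  fixes F :: "complex \<Rightarrow> complex" and n :: "nat \<Rightarrow> nat" and a :: "nat \<Rightarrow> nat \<Rightarrow> real"
  assumes a_pos: "i < n N \<Longrightarrow> 0 < a N i"
    and lim: "uniform_limit (cball 0 R) (\<lambda>N z. \<Prod>i<n N. 1 - of_real (a N i) * z) F sequentially"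
begin

definition P :: "nat \<Rightarrow> complex \<Rightarrow> complex" where
  "P N z = (\<Prod>i<n N. 1 - of_real (a N i) * z)"

definition Fr :: "real \<Rightarrow> real" where
  "Fr x = Re (F (of_real x))"

definition S :: "complex \<Rightarrow> complex" where
  "S z = - (z * deriv F z) / F z"

definition c1 :: real where
  "c1 = - Re (deriv F 0)"

definition c2 :: real where
  "c2 = Re ((deriv ^^ 2) F 0) / 2"

text \<open>The interval is closed so that \<open>Fr\<close> has a positive minimum on it; this is
  what keeps the zeros of the approximants away.\<close>

definition good :: "real \<Rightarrow> bool" where
  "good x \<longleftrightarrow> 0 \<le> x \<and> (\<forall>s\<in>{0..x}. 0 < Fr s)"

section \<open>Convergence of the approximants and their derivatives\<close>

lemma uniform_limit_P: "uniform_limit (cball 0 R) P F sequentially"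
  using lim[of R] unfolding P_def by simp

lemma holomorphic_P: "P N holomorphic_on A"
  unfolding P_def by (intro holomorphic_intros)

lemma P_tendsto: "(\<lambda>N. P N z) \<longlonglongrightarrow> F z"
  by (rule tendsto_uniform_limitI[OF uniform_limit_P[of "norm z"]]) auto

lemma holomorphic_F: "F holomorphic_on A"
proof -
  have "F holomorphic_on UNIV"
  proof (rule holomorphic_uniform_sequence[of _ P])
    fix z :: complex
    have "cball z 1 \<subseteq> cball 0 (norm z + 1)"
      by (simp add: cball_subset_cball_iff)
    then have "uniform_limit (cball z 1) P F sequentially"
      by (rule uniform_limit_on_subset[OF uniform_limit_P])
    then show "\<exists>d>0. cball z d \<subseteq> UNIV \<and> uniform_limit (cball z d) P F sequentially"
      by (intro exI[of _ 1]) auto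
  qed (auto intro: holomorphic_P)
  then show ?thesis by (rule holomorphic_on_subset) auto
qed

lemma deriv_P_tendsto: "(\<lambda>N. (deriv ^^ m) (P N) z) \<longlonglongrightarrow> (deriv ^^ m) F z"
  by (rule higher_deriv_complex_uniform_limit[where A = "ball 0 (norm z + 1)"])
    (auto intro!: always_eventually holomorphic_P
      uniform_limit_on_subset[OF uniform_limit_P[of "norm z + 1"]])

lemma F_0: "F 0 = 1"
  using P_tendsto[of 0] by (simp add: P_def LIMSEQ_const_iff)

lemma P_of_real: "P N (of_real x) = of_real (\<Prod>i<n N. 1 - a N i * x)"
  by (simp add: P_def)

lemma F_of_real: "F (of_real x) = of_real (Fr x)"
proof -
  have "(\<lambda>N. Im (P N (of_real x))) \<longlonglongrightarrow> Im (F (of_real x))"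
    by (intro tendsto_intros P_tendsto)
  then have "Im (F (of_real x)) = 0"
    by (simp only: P_of_real Im_complex_of_real LIMSEQ_const_iff)
  then show ?thesis by (simp add: Fr_def complex_eq_iff)
qed

lemma has_field_derivative_F: "(F has_field_derivative deriv F z) (at z)"
  using holomorphic_F[of UNIV] holomorphic_derivI[of F UNIV z] by auto

lemma has_real_derivative_Fr: "(Fr has_real_derivative Re (deriv F (of_real x))) (at x)"
  unfolding Fr_def has_real_derivative_iff_has_vector_derivative
  by (intro bounded_linear.has_vector_derivative[OF bounded_linear_Re] has_vector_derivative_real_field
      has_field_derivative_F)

lemma continuous_Fr: "continuous_on A Fr"
  using has_real_derivative_Fr
  by (meson DERIV_isCont continuous_at_imp_continuous_on)

text \<open>A zero \<open>1 / a N i\<close> in [0, x] would, by uniform convergence, make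
  \<open>F\<close> at that point smaller than the positive minimum of \<open>Fr\<close> on
  [0, x].\<close>

lemma eventually_small:
  assumes "good x"
  shows "\<forall>\<^sub>F N in sequentially. \<forall>i<n N. a N i * x < 1"
proof -
  have "\<exists>m\<in>{0..x}. \<forall>s\<in>{0..x}. Fr m \<le> Fr s"
    using assms by (intro continuous_attains_inf continuous_Fr) (auto simp: good_def)
  then obtain m where m: "m \<in> {0..x}" "\<forall>s\<in>{0..x}. Fr m \<le> Fr s" by blast
  have "0 < Fr m"
    using m assms by (auto simp: good_def)
  then have "\<forall>\<^sub>F N in sequentially. \<forall>z\<in>cball 0 x. dist (P N z) (F z) < Fr m"
    using uniform_limitD[OF uniform_limit_P] by blast
  then show ?thesis
  proof eventually_elim
    case (elim N)
    show ?case
    proof (intro allI impI, rule ccontr)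
      fix i assume i: "i < n N" and "\<not> a N i * x < 1"
      then have s: "1 / a N i \<in> {0..x}"
        using a_pos[OF i] by (auto simp: field_simps)
      have "P N (of_real (1 / a N i)) = 0"
        using i a_pos[OF i] unfolding P_def by (intro prod_zero) auto
      moreover have "of_real (1 / a N i) \<in> cball (0::complex) x"
        using s by (simp only: mem_cball dist_0_norm norm_of_real) auto
      ultimately have "norm (F (of_real (1 / a N i))) < Fr m"
        using elim by (metis dist_0_norm)
      then show False
        using m(2) s unfolding F_of_real by fastforce
    qed
  qed
qed

lemma tendsto_sum_a: "(\<lambda>N. \<Sum>i<n N. a N i) \<longlonglongrightarrow> c1"
proof -
  have "deriv (P N) 0 = - of_real (\<Sum>i<n N. a N i)" for N
    using deriv_prod_linear_0(1)[of "{..<n N}" "\<lambda>i. of_real (a N i)"] by (simp add: P_def[abs_def])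
  moreover have "(\<lambda>N. - Re (deriv (P N) 0)) \<longlonglongrightarrow> c1"
    unfolding c1_def using deriv_P_tendsto[of 1 0] by (intro tendsto_intros) auto
  ultimately show ?thesis by simp
qed

text \<open>Newton's identity in the limit: the second power sum is e1^2 - 2 e2.\<close>

lemma tendsto_sum_a2: "(\<lambda>N. \<Sum>i<n N. (a N i)\<^sup>2) \<longlonglongrightarrow> c1\<^sup>2 - 2 * c2"
proof -
  have *: "(deriv ^^ 2) (P N) 0 = of_real ((\<Sum>i<n N. a N i)\<^sup>2 - (\<Sum>i<n N. (a N i)\<^sup>2))" for N
    using deriv_prod_linear_0(2)[of "{..<n N}" "\<lambda>i. of_real (a N i)"] by (simp add: P_def[abs_def])
  have "(\<lambda>N. (\<Sum>i<n N. a N i)\<^sup>2 - Re ((deriv ^^ 2) (P N) 0)) \<longlonglongrightarrow> c1\<^sup>2 - 2 * c2"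
    unfolding c2_def by (auto intro!: tendsto_eq_intros tendsto_sum_a deriv_P_tendsto)
  then show ?thesis unfolding * by simp
qed

lemma c1_square_ge: "2 * c2 \<le> c1\<^sup>2"
proof -
  have "0 \<le> c1\<^sup>2 - 2 * c2"
    by (rule LIMSEQ_le_const[OF tendsto_sum_a2]) (auto intro!: sum_nonneg)
  then show ?thesis by simp
qed

text \<open>Factor by factor, |1 - a z| is at least 1 - a |z|. Thus positivity on the segment [0, x]
  excludes zeros from the whole closed disk of radius x.\<close>

lemma norm_F_ge:
  assumes "good x" "norm z \<le> x"
  shows "Fr (norm z) \<le> norm (F z)"
proof -
  have "\<forall>\<^sub>F N in sequentially. Re (P N (of_real (norm z))) \<le> norm (P N z)"
    using eventually_small[OF assms(1)]
  proof eventually_elim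
    case (elim N)
    have "(\<Prod>i<n N. 1 - a N i * norm z) \<le> (\<Prod>i<n N. norm (1 - of_real (a N i) * z))"
    proof (intro prod_mono conjI)
      fix i assume "i \<in> {..<n N}"
      then have i: "i < n N" by simp
      have "a N i * norm z \<le> a N i * x"
        using assms(2) a_pos[OF i] by (intro mult_left_mono) auto
      then show "0 \<le> 1 - a N i * norm z"
        using elim i by force
      show "1 - a N i * norm z \<le> norm (1 - of_real (a N i) * z)"
        using norm_triangle_ineq2[of 1 "of_real (a N i) * z"] a_pos[OF i] by (simp add: norm_mult)
    qed
    then show ?case by (simp only: P_of_real Re_complex_of_real) (simp add: P_def prod_norm)
  qed
  then have "Re (F (of_real (norm z))) \<le> norm (F z)"
    by (intro tendsto_le[OF _ tendsto_norm[OF P_tendsto] tendsto_Re[OF P_tendsto]]) auto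
  then show ?thesis by (simp add: Fr_def)
qed

section \<open>The logarithmic derivative of the limit\<close>

lemma F_nonzero:
  assumes "good x" "norm z \<le> x"
  shows "F z \<noteq> 0"
proof -
  have "0 < Fr (norm z)"
    using assms by (auto simp: good_def)
  then show ?thesis using norm_F_ge[OF assms] by auto
qed

text \<open>Quotients converge because \<open>F z\<close> is nonzero;
  \<open>eventually_small\<close> keeps z off the poles of the partial fractions.\<close>

lemma S_tendsto:
  assumes "good x" "norm z \<le> x"
  shows "(\<lambda>N. \<Sum>i<n N. of_real (a N i) * z / (1 - of_real (a N i) * z)) \<longlonglongrightarrow> S z"
proof (rule Lim_transform_eventually)
  show "(\<lambda>N. - (z * deriv (P N) z) / P N z) \<longlonglongrightarrow> S z"
    unfolding S_def using deriv_P_tendsto[of 1 z] F_nonzero[OF assms]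
    by (intro tendsto_intros P_tendsto) auto
  show "\<forall>\<^sub>F N in sequentially. - (z * deriv (P N) z) / P N z =
      (\<Sum>i<n N. of_real (a N i) * z / (1 - of_real (a N i) * z))"
    using eventually_small[OF assms(1)]
  proof eventually_elim
    case (elim N)
    have "of_real (a N i) * z \<noteq> 1" if i: "i < n N" for i
    proof
      assume "of_real (a N i) * z = 1"
      then have "norm (of_real (a N i) * z) = 1" by simp
      then have "a N i * norm z = 1"
        using a_pos[OF i] by (simp add: norm_mult)
      moreover have "a N i * norm z \<le> a N i * x"
        using assms(2) a_pos[OF i] by (intro mult_left_mono) auto
      ultimately show False using elim i by force
    qed
    then show ?case
      unfolding P_def[abs_def] by (intro logderiv_prod_linear) auto
  qed
qed

definition Sr :: "real \<Rightarrow> real" where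
  "Sr x = - (x * Re (deriv F (of_real x))) / Fr x"

lemma S_of_real: "Re (S (of_real x)) = Sr x"
  by (simp add: S_def Sr_def F_of_real Re_divide_of_real)

lemma Sr_tendsto:
  assumes "good x"
  shows "(\<lambda>N. \<Sum>i<n N. a N i * x / (1 - a N i * x)) \<longlonglongrightarrow> Sr x"
proof -
  have "(\<lambda>N. Re (\<Sum>i<n N. of_real (a N i) * of_real x / (1 - of_real (a N i) * of_real x)))
      \<longlonglongrightarrow> Re (S (of_real x))"
    using assms by (intro tendsto_Re S_tendsto[of x]) (auto simp: good_def)
  moreover have "(\<Sum>i<n N. of_real (a N i) * of_real x / (1 - of_real (a N i) * of_real x)) =
      complex_of_real (\<Sum>i<n N. a N i * x / (1 - a N i * x))" for N
    by simp
  ultimately show ?thesis by (simp only: S_of_real Re_complex_of_real)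
qed

lemma good_mono: "good x \<Longrightarrow> 0 \<le> y \<Longrightarrow> y \<le> x \<Longrightarrow> good y"
  by (auto simp: good_def)

lemma Re_S_le:
  assumes "good x" "norm z \<le> x"
  shows "Re (S z) \<le> Sr (norm z)"
proof (rule tendsto_le[OF _ Sr_tendsto tendsto_Re[OF S_tendsto[OF assms]]])
  show good: "good (norm z)"
    using assms good_mono by simp
  show "\<forall>\<^sub>F N in sequentially. Re (\<Sum>i<n N. of_real (a N i) * z / (1 - of_real (a N i) * z))
      \<le> (\<Sum>i<n N. a N i * norm z / (1 - a N i * norm z))"
    using eventually_small[OF good]
  proof eventually_elim
    case (elim N)
    show ?case unfolding Re_sum
    proof (rule sum_mono)
      fix i assume "i \<in> {..<n N}"
      then show "Re (of_real (a N i) * z / (1 - of_real (a N i) * z))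
          \<le> a N i * norm z / (1 - a N i * norm z)"
        using Re_moebius_le[of "of_real (a N i) * z"] elim a_pos[of i N] by (simp add: norm_mult)
    qed
  qed
qed auto

text \<open>Termwise, v is at most v / (1 - v) for v in [0, 1). This linear growth forces
  \<open>Sr\<close> to reach the level t by x = t / c1 if \<open>good\<close> lasts that
  long.\<close>

lemma Sr_ge:
  assumes "good x"
  shows "c1 * x \<le> Sr x"
proof (rule tendsto_le[OF _ Sr_tendsto[OF assms] tendsto_mult_right[OF tendsto_sum_a]])
  have x: "0 \<le> x" using assms by (simp add: good_def)
  show "\<forall>\<^sub>F N in sequentially. (\<Sum>i<n N. a N i) * x \<le> (\<Sum>i<n N. a N i * x / (1 - a N i * x))"
    using eventually_small[OF assms]
  proof eventually_elim
    case (elim N)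
    show ?case unfolding sum_distrib_right
    proof (rule sum_mono)
      fix i assume "i \<in> {..<n N}"
      then have "0 \<le> a N i * x" "a N i * x < 1"
        using elim a_pos[of i N] x by auto
      then show "a N i * x \<le> a N i * x / (1 - a N i * x)"
        using mult_left_mono[of "1 - a N i * x" 1 "a N i * x"] by (simp add: pos_le_divide_eq)
    qed
  qed
qed auto

text \<open>The two finite inequalities for \<open>b i = a N i * x / (1 - a N i * x)\<close>, where
  b / (1 + b) is \<open>a N i * x\<close>. The limit makes them weak, but the terms in
  \<open>c2\<close> preserve the gap.\<close>

lemma Sr_bounds:
  assumes "good x"
  shows "2 * c2 * x\<^sup>2 \<le> (1 + Sr x) * (c1 * x) - Sr x" (is ?thesis1)
    and "0 < Sr x \<Longrightarrow> (c1 * x)\<^sup>2 + Sr x * (Sr x + 2) * ((c1\<^sup>2 - 2 * c2) * x\<^sup>2)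
           + Sr x / (1 + Sr x)\<^sup>2 * (2 * c2 * x\<^sup>2) \<le> Sr x * (Sr x + 1) * (c1 * x)" (is "_ \<Longrightarrow> ?thesis2")
proof -
  define t where "t = (\<lambda>N. \<Sum>i<n N. a N i * x / (1 - a N i * x))"
  define s where "s = (\<lambda>N. (\<Sum>i<n N. a N i) * x)"
  define s2 where "s2 = (\<lambda>N. (\<Sum>i<n N. (a N i)\<^sup>2) * x\<^sup>2)"
  have x: "0 \<le> x" using assms by (simp add: good_def)
  have t: "t \<longlonglongrightarrow> Sr x"
    using Sr_tendsto[OF assms] by (simp add: t_def)
  have s: "s \<longlonglongrightarrow> c1 * x" and s2: "s2 \<longlonglongrightarrow> (c1\<^sup>2 - 2 * c2) * x\<^sup>2"
    unfolding s_def s2_def by (intro tendsto_intros tendsto_sum_a tendsto_sum_a2)+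
  have b: "\<forall>\<^sub>F N in sequentially. (s N)\<^sup>2 - s2 N \<le> (1 + t N) * s N - t N \<and>
    (0 < t N \<longrightarrow> (s N)\<^sup>2 + t N * (t N + 2) * s2 N + t N / (1 + t N)\<^sup>2 * ((s N)\<^sup>2 - s2 N)
      \<le> t N * (t N + 1) * s N)"
    using eventually_small[OF assms]
  proof eventually_elim
    case (elim N)
    define b where "b = (\<lambda>i. a N i * x / (1 - a N i * x))"
    have b: "0 \<le> b i" "b i / (1 + b i) = a N i * x" if "i \<in> {..<n N}" for i
      using that elim a_pos[of i N] x by (auto simp: b_def field_simps)
    have "t N = sum b {..<n N}" "s N = (\<Sum>i<n N. b i / (1 + b i))"
      "s2 N = (\<Sum>i<n N. (b i / (1 + b i))\<^sup>2)"
      using b(2) by (auto simp: t_def s_def s2_def sum_distrib_right power_mult_distrib)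
        (auto simp: b_def)
    then show ?case
      using sum_ratio_lower[of "{..<n N}" b] sum_ratio_upper[of "{..<n N}" b] b(1) by auto
  qed
  from b have b1: "\<forall>\<^sub>F N in sequentially. (s N)\<^sup>2 - s2 N \<le> (1 + t N) * s N - t N"
    by eventually_elim auto
  have "(c1 * x)\<^sup>2 - (c1\<^sup>2 - 2 * c2) * x\<^sup>2 \<le> (1 + Sr x) * (c1 * x) - Sr x"
    by (rule tendsto_le[OF _ _ _ b1]) (auto intro!: tendsto_intros t s s2)
  then show ?thesis1 by (simp add: algebra_simps power2_eq_square)
  assume pos: "0 < Sr x"
  then have "\<forall>\<^sub>F N in sequentially. 0 < t N"
    using order_tendstoD(1)[OF t] by blast
  with b have b': "\<forall>\<^sub>F N in sequentially. (s N)\<^sup>2 + t N * (t N + 2) * s2 N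
      + t N / (1 + t N)\<^sup>2 * ((s N)\<^sup>2 - s2 N) \<le> t N * (t N + 1) * s N"
    by eventually_elim auto
  have "(c1 * x)\<^sup>2 + Sr x * (Sr x + 2) * ((c1\<^sup>2 - 2 * c2) * x\<^sup>2)
      + Sr x / (1 + Sr x)\<^sup>2 * ((c1 * x)\<^sup>2 - (c1\<^sup>2 - 2 * c2) * x\<^sup>2) \<le> Sr x * (Sr x + 1) * (c1 * x)"
    by (rule tendsto_le[OF _ _ _ b']) (use pos in \<open>auto intro!: tendsto_intros t s s2\<close>)
  moreover have "(c1 * x)\<^sup>2 - (c1\<^sup>2 - 2 * c2) * x\<^sup>2 = 2 * c2 * x\<^sup>2"
    by (simp add: algebra_simps power2_eq_square)
  ultimately show ?thesis2 by simp
qed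

text \<open>The root is the first zero of \<open>\<phi>\<close>, which is
  \<open>Fr y * (t - Sr y)\<close> wherever \<open>Fr y\<close> is nonzero, yet is continuous
  without regard to zeros of \<open>Fr\<close>. The last two conclusions are
  \<open>Sr_bounds\<close> at \<open>Sr x = t\<close>.\<close>

lemma exists_starlike_root:
  assumes t: "0 < t" and c1: "0 < c1" and c2: "0 < c2"
  obtains x where "0 < x" "F (of_real x) \<noteq> 0" "Re (S (of_real x)) = t"
    "\<And>z. norm z < x \<Longrightarrow> F z \<noteq> 0" "\<And>z. norm z < x \<Longrightarrow> Re (S z) < t"
    "1 / x < (1 + 1 / t) * c1"
    "(1 + 1 / t) * c1 - 2 * (t + 2) / (t + 1) * (c2 / c1) < 1 / x"
proof -
  define \<phi> where "\<phi> = (\<lambda>y. t * Fr y + y * Re (deriv F (of_real y)))"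
  have "isCont (\<lambda>y. deriv F (of_real y)) y" for y
  proof -
    have "isCont (deriv F) (of_real y)"
      using holomorphic_deriv[OF holomorphic_F open_UNIV] holomorphic_on_imp_continuous_on
        continuous_on_eq_continuous_at open_UNIV by blast
    then show ?thesis
      by (rule isCont_o2[rotated]) (intro continuous_intros)
  qed
  then have cont: "isCont \<phi> y" for y
    unfolding \<phi>_def using DERIV_isCont[OF has_real_derivative_Fr]
    by (intro continuous_intros) auto
  have Fr_0: "Fr 0 = 1"
    using F_0 by (simp add: Fr_def)
  have \<phi>_0: "\<phi> 0 = t"
    by (simp add: \<phi>_def Fr_0)
  \<comment> \<open>\<open>\<phi> > 0\<close> says that \<open>y\<^sup>t F(y)\<close> increases.\<close>
  have good: "good x" if x: "0 \<le> x" and pos: "\<And>y. 0 < y \<Longrightarrow> y < x \<Longrightarrow> 0 < \<phi> y" for x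
  proof -
    have "isCont Fr 0"
      using has_real_derivative_Fr DERIV_isCont by blast
    then have "\<forall>\<^sub>F y in at 0. 0 < Fr y"
      using order_tendstoD(1)[of Fr "Fr 0"] by (simp add: isCont_def Fr_0)
    then obtain d where d: "0 < d" "\<And>y. y \<noteq> 0 \<Longrightarrow> \<bar>y\<bar> < d \<Longrightarrow> 0 < Fr y"
      by (auto simp: eventually_at dist_real_def)
    have "0 < Fr s" if s: "0 \<le> s" "s \<le> x" for s
    proof (cases "s < d")
      case True
      then show ?thesis using d(2)[of s] s Fr_0 by (cases "s = 0") auto
    next
      case False
      define e where "e = d / 2"
      have e: "0 < e" "e < s" "0 < Fr e"
        using d False by (auto simp: e_def)
      define G where "G = (\<lambda>y. y powr t * Fr y)"
      have dG: "(G has_real_derivative y powr (t - 1) * \<phi> y) (at y)" if "0 < y" for y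
      proof -
        have "(G has_real_derivative
            t * y powr (t - 1) * Fr y + Re (deriv F (of_real y)) * y powr t) (at y)"
          unfolding G_def using that
          by (auto intro!: derivative_eq_intros has_real_derivative_Fr)
        moreover have "y powr t = y * y powr (t - 1)"
          using that powr_mult_base[of y "t - 1"] by simp
        ultimately show ?thesis
          by (simp add: \<phi>_def algebra_simps)
      qed
      have "G e < G s"
      proof (rule DERIV_pos_imp_increasing_open[OF e(2)])
        fix y assume "e < y" "y < s"
        then show "\<exists>D. (G has_real_derivative D) (at y) \<and> 0 < D"
          using dG[of y] pos[of y] e s by (intro exI[of _ "y powr (t - 1) * \<phi> y"]) auto
      next
        show "continuous_on {e..s} G"
          using dG e by (intro continuous_at_imp_continuous_on ballI DERIV_isCont[OF dG]) auto
      qed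
      moreover have "0 < G e"
        using e by (simp add: G_def)
      ultimately have "0 < s powr t * Fr s"
        by (simp add: G_def)
      then show ?thesis
        by (simp add: zero_less_mult_iff not_less[symmetric])
    qed
    then show ?thesis using x by (auto simp: good_def)
  qed
  have Sr_less: "Sr y < t" if "good y" "0 < \<phi> y" for y
  proof -
    have "0 < Fr y" using that by (auto simp: good_def)
    then show ?thesis using that(2) by (simp add: Sr_def \<phi>_def field_simps)
  qed
  \<comment> \<open>Otherwise \<open>t / c1\<close> is \<open>good\<close>, and there
    \<open>Sr\<close> is below t by \<open>Sr_less\<close> but at least t by
    \<open>Sr_ge\<close>.\<close>
  have "\<exists>y>0. \<phi> y \<le> 0"
  proof (rule ccontr)
    assume "\<not> (\<exists>y>0. \<phi> y \<le> 0)"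
    then have pos: "0 < \<phi> y" if "0 < y" for y
      using that not_less by blast
    have g: "good (t / c1)"
      using t c1 pos by (intro good) auto
    show False
      using Sr_less[OF g pos] Sr_ge[OF g] t c1 by simp
  qed
  then obtain y0 where y0: "0 < y0" "\<phi> y0 \<le> 0"
    by blast
  \<comment> \<open>Compactness makes the smallest zero attained, and
    \<open>\<phi> 0 = t > 0\<close> keeps it away from 0.\<close>
  define A where "A = {y \<in> {0..y0}. \<phi> y = 0}"
  have contA: "continuous_on {0..y} \<phi>" for y
    using cont by (intro continuous_at_imp_continuous_on) auto
  have "compact A"
  proof -
    have "A = {0..y0} \<inter> \<phi> -` {0}" by (auto simp: A_def)
    then have "closed A"
      using continuous_closed_preimage[OF contA closed_real_atLeastAtMost, of "{0}"] by simp
    moreover have "bounded A"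
      by (rule bounded_subset[of "{0..y0}"]) (auto simp: A_def)
    ultimately show ?thesis by (simp add: compact_eq_bounded_closed)
  qed
  have root: "\<exists>z. 0 \<le> z \<and> z \<le> y \<and> \<phi> z = 0" if "0 \<le> y" "\<phi> y \<le> 0" for y
    using IVT2'[of \<phi> y 0 0] contA that \<phi>_0 t by auto
  have "A \<noteq> {}"
  proof -
    obtain z where "0 \<le> z" "z \<le> y0" "\<phi> z = 0"
      using root[of y0] y0 by auto
    then show ?thesis by (auto simp: A_def)
  qed
  with \<open>compact A\<close> obtain x where x: "x \<in> A" "\<forall>y\<in>A. x \<le> y"
    using compact_attains_inf[of A] by blast
  have x0: "0 < x" "\<phi> x = 0"
    using x(1) \<phi>_0 t unfolding A_def by (auto simp: less_le)
  have below: "0 < \<phi> y" if y: "0 \<le> y" "y < x" for y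
  proof (rule ccontr)
    assume "\<not> 0 < \<phi> y"
    then obtain z where "0 \<le> z" "z \<le> y" "\<phi> z = 0"
      using root[of y] y by auto
    then show False
      using x y by (force simp: A_def)
  qed
  have gx: "good x"
    using x0 below by (intro good) auto
  have Fx: "0 < Fr x"
    using gx by (auto simp: good_def)
  have Sx: "Sr x = t"
    using x0 Fx by (simp add: Sr_def \<phi>_def field_simps)
  \<comment> \<open>The positive \<open>c2\<close> term turns the weak inequality of the limit into
    a strict one; the lower bound for \<open>1 / x\<close> is made strict in the same way.\<close>
  have "t < (1 + t) * (c1 * x)"
  proof -
    have "0 < 2 * c2 * x\<^sup>2"
      using c2 x0 by simp
    then show ?thesis
      using Sr_bounds(1)[OF gx] unfolding Sx by linarith
  qed
  then have upper: "1 / x < (1 + 1 / t) * c1"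
    using x0 t by (simp add: field_simps)
  have "0 < t / (1 + t)\<^sup>2 * (2 * c2 * x\<^sup>2)"
    using t c2 x0 by simp
  then have "(c1 * x)\<^sup>2 + t * (t + 2) * ((c1\<^sup>2 - 2 * c2) * x\<^sup>2) < t * (t + 1) * (c1 * x)"
    using Sr_bounds(2)[OF gx] t unfolding Sx by linarith
  then have "x * ((t + 1)\<^sup>2 * c1\<^sup>2 * x - 2 * t * (t + 2) * c2 * x) < x * (t * (t + 1) * c1)"
    by (simp add: algebra_simps power2_eq_square)
  then have "(t + 1)\<^sup>2 * c1\<^sup>2 * x - 2 * t * (t + 2) * c2 * x < t * (t + 1) * c1"
    using x0 by simp
  \<comment> \<open>Division by t (t + 1) c1 is the origin of the constants 1 + 1 / t and 2 (t + 2)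
    / (t + 1).\<close>
  moreover have "((1 + 1 / t) * c1 - 2 * (t + 2) / (t + 1) * (c2 / c1)) * x * (t * (t + 1) * c1) =
      (t + 1)\<^sup>2 * c1\<^sup>2 * x - 2 * t * (t + 2) * c2 * x"
    using t c1 by (simp add: divide_simps) algebra
  ultimately have "((1 + 1 / t) * c1 - 2 * (t + 2) / (t + 1) * (c2 / c1)) * x * (t * (t + 1) * c1)
      < 1 * (t * (t + 1) * c1)"
    by linarith
  then have "((1 + 1 / t) * c1 - 2 * (t + 2) / (t + 1) * (c2 / c1)) * x < 1"
    by (rule mult_right_less_imp_less) (use t c1 in auto)
  then have lower: "(1 + 1 / t) * c1 - 2 * (t + 2) / (t + 1) * (c2 / c1) < 1 / x"
    using x0 by (simp add: pos_less_divide_eq)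
  show ?thesis
  proof (rule that[OF x0(1) _ _ _ _ upper lower])
    show "F (of_real x) \<noteq> 0"
      using F_nonzero[OF gx] x0 by simp
    show "Re (S (of_real x)) = t"
      using Sx by (simp add: S_of_real)
    fix z :: complex assume z: "norm z < x"
    then show "F z \<noteq> 0"
      using F_nonzero[OF gx] by simp
    have "good (norm z)"
      using good_mono[OF gx] z by simp
    then have "Sr (norm z) < t"
      using Sr_less below z by simp
    then show "Re (S z) < t"
      using Re_S_le[OF gx, of z] z by simp
  qed
qed

end

section \<open>Real-rooted approximants\<close>

text \<open>Induction on the degree: a root r is split off as 1 - z / r, which keeps the value 1 at
  0.\<close>

lemma poly_eq_prod_linear:
  fixes p :: "complex poly"
  assumes "poly p 0 = 1" and "\<And>z. poly p z = 0 \<Longrightarrow> \<exists>r>0. z = of_real r"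
  shows "\<exists>(n::nat) a. (\<forall>i<n. 0 < a i) \<and> (\<forall>z. poly p z = (\<Prod>i<n. 1 - of_real (a i) * z))"
  using assms
proof (induction "degree p" arbitrary: p)
  case 0
  then obtain c where "p = [:c:]" by (metis degree_0_id)
  with 0 show ?case
    by (intro exI[of _ 0]) auto
next
  case (Suc m)
  then have "\<not> constant (poly p)"
    by (simp add: constant_degree)
  then obtain z where "poly p z = 0"
    using fundamental_theorem_of_algebra by blast
  then obtain r where r: "0 < r" "poly p (of_real r) = 0"
    using Suc.prems(2) by blast
  then obtain g where g: "p = [:- of_real r, 1:] * g"
    by (auto simp: poly_eq_0_iff_dvd elim: dvdE)
  define h where "h = smult (- of_real r) g"
  have ph: "poly p z = (1 - of_real (1 / r) * z) * poly h z" for z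
    using r by (simp add: g h_def algebra_simps)
  have "g \<noteq> 0"
    using Suc.prems(1) g by auto
  then have "degree p = Suc (degree g)"
    unfolding g by (subst degree_mult_eq) auto
  then have "m = degree h"
    using Suc.hyps(2) r by (simp add: h_def)
  moreover have "poly h 0 = 1"
    using Suc.prems(1) ph[of 0] by simp
  moreover have "\<exists>r>0. z = of_real r" if "poly h z = 0" for z
    using Suc.prems(2)[of z] ph[of z] that by simp
  ultimately have "\<exists>(n::nat) a. (\<forall>i<n. 0 < a i) \<and>
      (\<forall>z. poly h z = (\<Prod>i<n. 1 - of_real (a i) * z))"
    by (rule Suc.hyps(1))
  then obtain n :: nat and a where a: "\<forall>i<n. 0 < a i"
      "\<forall>z. poly h z = (\<Prod>i<n. 1 - of_real (a i) * z)"
    by blast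
  show ?case
  proof (intro exI[of _ "Suc n"] exI[of _ "a(n := 1 / r)"] conjI allI impI)
    fix i assume "i < Suc n"
    then show "0 < (a(n := 1 / r)) i" using a(1) r(1) by auto
  next
    fix z :: complex
    have "(\<Prod>i<n. 1 - of_real ((a(n := 1 / r)) i) * z) = (\<Prod>i<n. 1 - of_real (a i) * z)"
      by (intro prod.cong) auto
    then show "poly p z = (\<Prod>i<Suc n. 1 - of_real ((a(n := 1 / r)) i) * z)"
      using ph[of z] a(2) by (simp add: mult.commute)
  qed
qed

text \<open>Real zeros are positive here: for r <= 0 alternating signs make every term nonnegative,
  and the constant term is 1. The majorant \<open>M\<close> feeds Tannery's theorem, which upgrades
  coefficientwise convergence to uniform convergence on disks.\<close>

lemma positive_zeros_limit_of_coeffs: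
  fixes d :: "nat \<Rightarrow> nat \<Rightarrow> real"
  assumes deg: "\<And>N k. N < k \<Longrightarrow> d N k = 0" and d0: "\<And>N. d N 0 = 1"
    and alt: "\<And>N k. 0 \<le> (- 1) ^ k * d N k"
    and real: "\<And>N z. (\<Sum>k\<le>N. of_real (d N k) * z ^ k) = (0::complex) \<Longrightarrow> z \<in> \<real>"
    and lim: "\<And>k. (\<lambda>N. d N k) \<longlonglongrightarrow> c k"
    and bound: "\<And>N k. \<bar>d N k\<bar> \<le> M k" and summ: "\<And>R. summable (\<lambda>k. M k * R ^ k)"
  shows "\<exists>n a. positive_zeros_limit (\<lambda>z. \<Sum>k. of_real (c k) * z ^ k) n a"
proof -
  define F where "F = (\<lambda>z::complex. \<Sum>k. of_real (c k) * z ^ k)"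
  define p where "p = (\<lambda>N. \<Sum>k\<le>N. monom (complex_of_real (d N k)) k)"
  have poly_p: "poly (p N) z = (\<Sum>k\<le>N. of_real (d N k) * z ^ k)" for N z
    by (simp add: p_def poly_sum poly_monom)
  have p0: "poly (p N) 0 = 1" for N
    using d0 unfolding poly_p by (subst sum.remove[of _ 0]) (auto intro!: sum.neutral)
  have pos: "\<exists>r>0. z = of_real r" if root: "poly (p N) z = 0" for N z
  proof -
    obtain r where r: "z = of_real r"
      using real[of N z] root unfolding poly_p by (auto elim: Reals_cases)
    have "0 < r"
    proof (rule ccontr)
      assume "\<not> 0 < r"
      then have "0 \<le> d N k * r ^ k" for k
        using zero_le_power[of "- r" k] mult_nonneg_nonneg[OF alt[of k N], of "(- r) ^ k"]
        by (cases "even k") auto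
      then have "d N 0 * r ^ 0 \<le> (\<Sum>k\<le>N. d N k * r ^ k)"
        by (intro member_le_sum) auto
      moreover have "poly (p N) z = of_real (\<Sum>k\<le>N. d N k * r ^ k)"
        by (simp add: poly_p r)
      ultimately show False
        using root d0 by (simp del: of_real_sum)
    qed
    then show ?thesis using r by blast
  qed
  have "\<forall>N. \<exists>na :: nat \<times> (nat \<Rightarrow> real). (\<forall>i<fst na. 0 < snd na i) \<and>
      (\<forall>z. poly (p N) z = (\<Prod>i<fst na. 1 - of_real (snd na i) * z))"
    using poly_eq_prod_linear[OF p0 pos] by simp
  then obtain na :: "nat \<Rightarrow> nat \<times> (nat \<Rightarrow> real)" where na: "\<forall>N. (\<forall>i<fst (na N). 0 < snd (na N) i) \<and>
      (\<forall>z. poly (p N) z = (\<Prod>i<fst (na N). 1 - of_real (snd (na N) i) * z))"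
    by (rule exE[OF choice])
  define n where "n = (\<lambda>N. fst (na N))"
  define a where "a = (\<lambda>N. snd (na N))"
  have a: "\<forall>i<n N. 0 < a N i" "\<forall>z. poly (p N) z = (\<Prod>i<n N. 1 - of_real (a N i) * z)" for N
    using na by (auto simp: n_def a_def)
  have cb: "\<bar>c k\<bar> \<le> M k" for k
    by (rule LIMSEQ_le_const2[OF tendsto_rabs[OF lim]]) (use bound in auto)
  have "uniform_limit (cball 0 R) (\<lambda>N. poly (p N)) F sequentially" for R
  proof (cases "0 \<le> R")
    case False
    then show ?thesis by (simp add: uniform_limit_iff)
  next
    case R: True
    define g where "g = (\<lambda>N. \<Sum>k. \<bar>d N k - c k\<bar> * R ^ k)"
    have db: "\<bar>d N k - c k\<bar> * R ^ k \<le> 2 * (M k * R ^ k)" for N k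
    proof -
      have "\<bar>d N k - c k\<bar> \<le> 2 * M k"
        using bound[of N k] cb[of k] by linarith
      then have "\<bar>d N k - c k\<bar> * R ^ k \<le> 2 * M k * R ^ k"
        using R by (intro mult_right_mono) auto
      then show ?thesis by (simp only: mult.assoc)
    qed
    have summ2: "summable (\<lambda>k. 2 * (M k * R ^ k))"
      by (intro summable_mult summ)
    have "(\<lambda>N. \<Sum>k. \<bar>d N k - c k\<bar> * R ^ k) \<longlonglongrightarrow> (\<Sum>k. \<bar>c k - c k\<bar> * R ^ k)"
    proof (rule tannerys_theorem[THEN conjunct2, THEN conjunct2])
      show "(\<lambda>N. \<bar>d N k - c k\<bar> * R ^ k) \<longlonglongrightarrow> \<bar>c k - c k\<bar> * R ^ k" for k
        by (intro tendsto_intros lim)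
      show "\<forall>\<^sub>F (k, N) in sequentially \<times>\<^sub>F sequentially. norm (\<bar>d N k - c k\<bar> * R ^ k) \<le> 2 * (M k * R ^ k)"
        using db R by (intro always_eventually) auto
    qed (use summ2 in auto)
    then have g0: "g \<longlonglongrightarrow> 0"
      by (simp add: g_def)
    have dist: "dist (poly (p N) z) (F z) \<le> g N" if z: "z \<in> cball 0 R" for N z
    proof -
      have zR: "norm z ^ k \<le> R ^ k" for k
        using z by (intro power_mono) auto
      have sc: "summable (\<lambda>k. of_real (c k) * z ^ k)"
      proof (rule summable_comparison_test'[OF summ[of R], of 0])
        show "norm (of_real (c k) * z ^ k) \<le> M k * R ^ k" for k
          using cb[of k] zR[of k] by (auto simp: norm_mult norm_power intro!: mult_mono order_trans[OF abs_ge_zero cb])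
      qed
      have sg: "summable (\<lambda>k. \<bar>d N k - c k\<bar> * R ^ k)"
        by (rule summable_comparison_test'[OF summ2, of 0]) (use db R in auto)
      have "(\<lambda>k. of_real (d N k) * z ^ k) sums poly (p N) z"
        unfolding poly_p by (rule sums_finite) (auto simp: deg)
      then have "(\<lambda>k. of_real (d N k) * z ^ k - of_real (c k) * z ^ k) sums (poly (p N) z - F z)"
        unfolding F_def by (intro sums_diff summable_sums sc)
      then have "poly (p N) z - F z = (\<Sum>k. of_real (d N k) * z ^ k - of_real (c k) * z ^ k)"
        by (simp add: sums_iff)
      also have "norm \<dots> \<le> g N"
        unfolding g_def
      proof (rule norm_suminf_le[OF _ sg])
        fix k
        have "norm (of_real (d N k) * z ^ k - of_real (c k) * z ^ k) = \<bar>d N k - c k\<bar> * norm z ^ k"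
          by (simp add: norm_mult norm_power flip: left_diff_distrib of_real_diff)
        then show "norm (of_real (d N k) * z ^ k - of_real (c k) * z ^ k) \<le> \<bar>d N k - c k\<bar> * R ^ k"
          using zR[of k] by (simp add: mult_left_mono)
      qed
      finally show ?thesis by (simp add: dist_norm)
    qed
    show ?thesis
      unfolding uniform_limit_iff
    proof (intro allI impI)
      fix e :: real assume "0 < e"
      then have "\<forall>\<^sub>F N in sequentially. g N < e"
        using order_tendstoD(2)[OF g0] by blast
      then show "\<forall>\<^sub>F N in sequentially. \<forall>z\<in>cball 0 R. dist (poly (p N) z) (F z) < e"
        by eventually_elim (use dist in \<open>meson le_less_trans\<close>)
    qed
  qed
  then have "positive_zeros_limit F n a"
    using a by unfold_locales (auto cong: uniform_limit_cong')
  then show ?thesis unfolding F_def by blast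
qed

text \<open>Removing the first term leaves \<open>b 0\<close> minus an alternating sum of the same
  kind.\<close>

lemma alternating_sum_bounds:
  fixes b :: "nat \<Rightarrow> real"
  assumes "\<And>j. 0 \<le> b j" "\<And>j. b (Suc j) \<le> b j"
  shows "0 \<le> (\<Sum>j<m. (- 1) ^ j * b j) \<and> (\<Sum>j<m. (- 1) ^ j * b j) \<le> b 0"
  using assms
proof (induction m arbitrary: b)
  case (Suc m)
  have "(\<Sum>j<Suc m. (- 1) ^ j * b j) = b 0 - (\<Sum>j<m. (- 1) ^ j * b (Suc j))"
    by (subst sum.lessThan_Suc_shift) (simp add: sum_negf)
  then show ?case
    using Suc.IH[of "\<lambda>j. b (Suc j)"] Suc.prems[of 0] Suc.prems by (smt (verit))
qed auto

text \<open>Hutchinson's argument: at \<open>x = 2 / \<rho> (k - 1)\<close> the \<open>k\<close>-th term dominates both neighbours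
  by a factor of at least two.\<close>

lemma truncation_real_zeros:
  fixes \<rho> :: "nat \<Rightarrow> real"
  assumes pos: "\<And>j. 0 < \<rho> j" and sep: "\<And>j. 4 * \<rho> (Suc j) < \<rho> j"
    and root: "(\<Sum>k\<le>N. of_real (\<Prod>j<k. - \<rho> j) * z ^ k) = (0::complex)"
  shows "z \<in> \<real>"
proof -
  define f where "f = (\<lambda>x. \<Sum>k\<le>N. (\<Prod>j<k. - \<rho> j) * x ^ k)"
  \<comment> \<open>The value \<open>x 0 = 0\<close> supplies the first sign, as
    \<open>f 0 = 1\<close>; with the other N points this gives N sign changes.\<close>
  define x where "x = (\<lambda>k. if k = 0 then 0 else 2 / \<rho> (k - 1))"
  have \<rho>_mono: "\<rho> j \<le> \<rho> i" if "i \<le> j" for i j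
    using that
  proof (rule lift_Suc_antimono_le[rotated])
    show "\<rho> (Suc k) \<le> \<rho> k" for k
      using sep[of k] pos[of "Suc k"] by linarith
  qed
  have x_mono: "x k < x (Suc k)" for k
  proof (cases k)
    case 0
    then show ?thesis using pos[of 0] by (simp add: x_def)
  next
    case (Suc m)
    then show ?thesis
      using sep[of m] pos[of m] pos[of "Suc m"] by (simp add: x_def field_simps)
  qed
  have sign: "0 < (- 1) ^ k * f (x k)" if k: "k \<le> N" for k
  proof (cases "k = 0")
    case True
    have "f 0 = 1"
      unfolding f_def by (subst sum.remove[of _ 0]) (auto intro!: sum.neutral)
    then show ?thesis using True by (simp add: x_def)
  next
    case False
    define T where "T = (\<lambda>i. (\<Prod>j<i. \<rho> j) * x k ^ i)"
    have xk: "0 < x k" "x k * \<rho> (k - 1) = 2"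
      using False pos[of "k - 1"] by (auto simp: x_def)
    have T_Suc: "T (Suc i) = \<rho> i * x k * T i" for i
      by (simp add: T_def)
    have T_pos: "0 < T i" for i
      unfolding T_def using xk pos by (intro mult_pos_pos prod_pos) auto
    have neg: "(\<Prod>j<i. - \<rho> j) = (- 1) ^ i * (\<Prod>j<i. \<rho> j)" for i
      by (induction i) auto
    have fT: "f (x k) = (\<Sum>i\<le>N. (- 1) ^ i * T i)"
      unfolding f_def T_def by (simp add: neg mult.assoc)
    have up: "2 * T i \<le> T (Suc i)" if "i < k" for i
    proof -
      have "2 \<le> \<rho> i * x k"
        using xk mult_left_mono[OF \<rho>_mono[of i "k - 1"], of "x k"] that by (simp add: mult.commute)
      then show ?thesis
        unfolding T_Suc using T_pos[of i] by (intro mult_right_mono) auto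
    qed
    have \<rho>k: "\<rho> k * x k < 1 / 2"
    proof -
      have "4 * \<rho> k < \<rho> (k - 1)"
        using sep[of "k - 1"] False by simp
      then have "x k * (4 * \<rho> k) < x k * \<rho> (k - 1)"
        using xk(1) by simp
      then show ?thesis using xk(2) by (simp only: mult.commute[of "x k"])
    qed
    have down: "T (Suc i) < T i / 2" if "k \<le> i" for i
    proof -
      have "\<rho> i * x k < 1 / 2"
        using \<rho>k \<rho>_mono[OF that] xk(1) by (smt (verit) mult_right_mono)
      then have "\<rho> i * x k * T i < 1 / 2 * T i"
        using T_pos[of i] by (rule mult_strict_right_mono)
      then show ?thesis by (simp add: T_Suc)
    qed
    \<comment> \<open>Up to index k the terms at least double, so a partial sum has the sign of its
      last term and at least half its size.\<close>
    have head: "T i / 2 \<le> (- 1) ^ i * (\<Sum>j\<le>i. (- 1) ^ j * T j) \<and>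
        (- 1) ^ i * (\<Sum>j\<le>i. (- 1) ^ j * T j) \<le> T i" if "i \<le> k" for i
      using that
    proof (induction i)
      case 0
      then show ?case using T_pos[of 0] by simp
    next
      case (Suc i)
      have "(- 1) ^ Suc i * (\<Sum>j\<le>Suc i. (- 1) ^ j * T j) =
          T (Suc i) - (- 1) ^ i * (\<Sum>j\<le>i. (- 1) ^ j * T j)"
        by (simp add: algebra_simps flip: power_mult_distrib mult.assoc)
      then show ?case
        using Suc up[of i] T_pos[of i] by (smt (verit) Suc_leD Suc_le_lessD field_sum_of_halves)
    qed
    \<comment> \<open>Beyond k the terms decrease, so the tail has size at most
      \<open>T (Suc k) < T k / 2\<close> and cannot cancel the head.\<close>
    have "(\<Sum>i\<le>N. (- 1) ^ i * T i) =
        (\<Sum>i\<le>k. (- 1) ^ i * T i) + (\<Sum>i=Suc k..<Suc N. (- 1) ^ i * T i)"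
      using k by (subst sum.union_disjoint[symmetric]) (auto intro!: sum.cong)
    also have "(\<Sum>i=Suc k..<Suc N. (- 1) ^ i * T i) = (\<Sum>j<N - k. (- 1) ^ (j + Suc k) * T (j + Suc k))"
      using sum.shift_bounds_nat_ivl[of "\<lambda>i. (- 1) ^ i * T i" 0 "Suc k" "N - k"] k
      by (simp add: lessThan_atLeast0)
    also have "\<dots> = - ((- 1) ^ k * (\<Sum>j<N - k. (- 1) ^ j * T (j + Suc k)))"
      by (simp add: sum_distrib_left power_add mult_ac sum_negf)
    finally have split: "f (x k) = (\<Sum>i\<le>k. (- 1) ^ i * T i)
        - (- 1) ^ k * (\<Sum>j<N - k. (- 1) ^ j * T (j + Suc k))"
      unfolding fT by simp
    have "(- 1) ^ k * ((- 1) ^ k * y) = y" for y :: real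
      by (simp flip: power_mult_distrib mult.assoc)
    then have "(- 1) ^ k * f (x k) = (- 1) ^ k * (\<Sum>i\<le>k. (- 1) ^ i * T i)
        - (\<Sum>j<N - k. (- 1) ^ j * T (j + Suc k))"
      unfolding split by (simp add: right_diff_distrib)
    moreover have "(\<Sum>j<N - k. (- 1) ^ j * T (j + Suc k)) \<le> T (0 + Suc k)"
    proof (rule alternating_sum_bounds[THEN conjunct2])
      show "T (Suc j + Suc k) \<le> T (j + Suc k)" for j
        using down[of "j + Suc k"] T_pos[of "j + Suc k"] by simp
    qed (use T_pos in \<open>auto intro: less_imp_le\<close>)
    ultimately show ?thesis
      using head[of k] down[of k] by simp
  qed
  have "\<exists>y>x k. y < x (Suc k) \<and> f y = 0" if k: "k < N" for k
  proof -
    define g where "g = (\<lambda>y. (- 1) ^ k * f y)"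
    have g: "0 < g (x k)" "g (x (Suc k)) < 0"
      using sign[of k] sign[of "Suc k"] k by (auto simp: g_def)
    have "continuous_on {x k..x (Suc k)} g"
      unfolding g_def f_def by (intro continuous_intros)
    then obtain y where y: "x k \<le> y" "y \<le> x (Suc k)" "g y = 0"
      using IVT2'[of g "x (Suc k)" 0 "x k"] g x_mono[of k] by auto
    with g have "y \<noteq> x k" "y \<noteq> x (Suc k)" by auto
    with y show ?thesis by (intro exI[of _ y]) (auto simp: g_def)
  qed
  then obtain y where y: "\<And>k. k < N \<Longrightarrow> x k < y k \<and> y k < x (Suc k) \<and> f (y k) = 0"
    by metis
  have xle: "x i \<le> x j" if "i \<le> j" for i j
    using that by (rule lift_Suc_mono_le[rotated]) (use x_mono in \<open>auto intro: less_imp_le\<close>)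
  have y_less: "y i < y j" if "i < j" "j < N" for i j
    using y[of i] y[of j] xle[of "Suc i" j] that by force
  have inj: "inj_on (\<lambda>k. complex_of_real (y k)) {..<N}"
    by (intro linorder_inj_onI) (use y_less in force)+
  \<comment> \<open>The N points \<open>y k\<close> are distinct and the degree is at most N, so no
    other complex zero is possible.\<close>
  define p where "p = (\<Sum>k\<le>N. monom (complex_of_real (\<Prod>j<k. - \<rho> j)) k)"
  have poly_p: "poly p w = (\<Sum>k\<le>N. of_real (\<Prod>j<k. - \<rho> j) * w ^ k)" for w
    by (simp add: p_def poly_sum poly_monom)
  have "poly p 0 = 1"
    unfolding poly_p by (subst sum.remove[of _ 0]) (auto intro!: sum.neutral)
  then have p: "p \<noteq> 0" by auto
  have "degree p \<le> N"
    unfolding p_def by (intro degree_sum_le) (auto intro: order_trans[OF degree_monom_le])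
  then have "card {w. poly p w = 0} \<le> card ((\<lambda>k. complex_of_real (y k)) ` {..<N})"
    using card_poly_roots_bound[OF p] by (simp add: card_image[OF inj])
  moreover have "poly p (of_real (y k)) = 0" if "k < N" for k
  proof -
    have "poly p (of_real (y k)) = of_real (f (y k))"
      by (simp add: poly_p f_def)
    then show ?thesis using y[OF that] by simp
  qed
  then have "(\<lambda>k. complex_of_real (y k)) ` {..<N} \<subseteq> {w. poly p w = 0}"
    by auto
  ultimately have "(\<lambda>k. complex_of_real (y k)) ` {..<N} = {w. poly p w = 0}"
    by (intro card_seteq poly_roots_finite p)
  moreover have "poly p z = 0"
    using root by (simp only: poly_p)
  ultimately have "z \<in> (\<lambda>k. complex_of_real (y k)) ` {..<N}"
    by blast
  then show ?thesis by auto
qed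

section \<open>Wall polynomials\<close>

text \<open>Coefficients of the little \<open>q\<close>-Laguerre polynomials with base \<open>p\<close>, the argument being rescaled so that
  the three-term recurrence in \<open>N\<close> holds at a fixed argument.\<close>

definition wall_coeff :: "real \<Rightarrow> real \<Rightarrow> nat \<Rightarrow> nat \<Rightarrow> real" where
  "wall_coeff p \<alpha> N k = (\<Prod>j<k. (1 - p ^ j / p ^ N) / ((1 - p ^ Suc j) * (1 - \<alpha> * p ^ j)))"

lemma wall_coeff_eq_0: "p \<noteq> 0 \<Longrightarrow> N < k \<Longrightarrow> wall_coeff p \<alpha> N k = 0"
  unfolding wall_coeff_def by (intro prod_zero) auto

text \<open>The little q-Laguerre recurrence around degree N + 1, coefficient by coefficient. In
  base p the usual parameter is \<open>\<alpha> / p\<close> and the usual argument is the present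
  one divided by p, whence the division by p in the last term.\<close>

lemma wall_coeff_recurrence:
  assumes p: "0 < p" "p < 1" and \<alpha>: "0 < \<alpha>" "\<alpha> < 1"
  defines "A \<equiv> \<lambda>N. p ^ Suc N * (1 - \<alpha> * p ^ Suc N)" and "C \<equiv> \<lambda>N. \<alpha> * p ^ N * (1 - p ^ Suc N)"
  shows "A N * wall_coeff p \<alpha> (N + 2) 0 =
      (A N + C N) * wall_coeff p \<alpha> (N + 1) 0 - C N * wall_coeff p \<alpha> N 0"
    and "A N * wall_coeff p \<alpha> (N + 2) (Suc k) = (A N + C N) * wall_coeff p \<alpha> (N + 1) (Suc k)
      - C N * wall_coeff p \<alpha> N (Suc k) - wall_coeff p \<alpha> (N + 1) k / p"
proof -
  show "A N * wall_coeff p \<alpha> (N + 2) 0 =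
      (A N + C N) * wall_coeff p \<alpha> (N + 1) 0 - C N * wall_coeff p \<alpha> N 0"
    by (simp add: wall_coeff_def)
  define U where "U = (\<lambda>N k. \<Prod>j<k. 1 - p ^ j / p ^ N)"
  define D where "D = (\<lambda>k. \<Prod>j<k. (1 - p ^ Suc j) * (1 - \<alpha> * p ^ j))"
  have W: "wall_coeff p \<alpha> N k = U N k / D k" for N k
    by (simp add: wall_coeff_def U_def D_def prod_dividef)
  define P where "P = p ^ N"
  define K where "K = p ^ k"
  have P: "0 < P" "P \<noteq> 0" using p by (auto simp: P_def)
  have pj: "p ^ Suc j < 1" "\<alpha> * p ^ j < 1" for j
    using p \<alpha> power_Suc_less_one[of p j] mult_less_le_imp_less[of \<alpha> 1 "p ^ j" 1]
    by (auto simp: power_le_one)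
  have D_pos: "0 < D k" for k
    unfolding D_def by (intro prod_pos mult_pos_pos) (use pj in auto)
  have D_Suc: "D (Suc k) = D k * ((1 - p * K) * (1 - \<alpha> * K))"
    by (simp add: D_def K_def)
  have nz: "1 - p * K \<noteq> 0" "1 - \<alpha> * K \<noteq> 0"
    using pj[of k] by (auto simp: K_def)
  have shift: "U (Suc M) (Suc k) = (1 - 1 / p ^ Suc M) * U M k" for M
    unfolding U_def by (subst prod.lessThan_Suc_shift) (use p in auto)
  have last: "U M (Suc k) = U M k * (1 - p ^ k / p ^ M)" for M
    by (simp add: U_def)
  \<comment> \<open>All three numerators are multiples of \<open>V\<close>. For the one of lowest
    degree the factor 1 - 1 / (p P) is kept on the left instead of being divided away, because
    \<open>C N\<close> contains it.\<close>
  define V where "V = U (N + 1) k"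
  have U2: "U (N + 2) (Suc k) = (1 - 1 / (p * p * P)) * V"
    using shift[of "N + 1"] by (simp add: V_def P_def)
  have U1: "U (N + 1) (Suc k) = V * (1 - K / (p * P))"
    using last[of "N + 1"] by (simp add: V_def P_def K_def)
  have U0: "U N (Suc k) * (1 - 1 / (p * P)) = V * (1 - K / (p * P)) * (1 - K / P)"
    using shift[of N] last[of "N + 1"] last[of N] by (simp add: V_def P_def K_def mult_ac)
  have C: "C N = - (\<alpha> * p * P\<^sup>2) * (1 - 1 / (p * P))"
    using p P by (simp add: C_def P_def[symmetric] field_simps power2_eq_square)
  have CU: "C N * U N (Suc k) = - (\<alpha> * p * P\<^sup>2) * (V * (1 - K / (p * P)) * (1 - K / P))"
    unfolding U0[symmetric] C by (simp only: mult_ac)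
  have "A N * U (N + 2) (Suc k) = (A N + C N) * U (N + 1) (Suc k) - C N * U N (Suc k)
      - U (N + 1) k / p * ((1 - p * K) * (1 - \<alpha> * K))"
    unfolding CU U2 U1 V_def[symmetric] unfolding A_def C_def power_Suc P_def[symmetric]
    using p P by (simp add: field_simps power2_eq_square)
  then show "A N * wall_coeff p \<alpha> (N + 2) (Suc k) = (A N + C N) * wall_coeff p \<alpha> (N + 1) (Suc k)
      - C N * wall_coeff p \<alpha> N (Suc k) - wall_coeff p \<alpha> (N + 1) k / p"
  proof -
    let ?E = "(1 - p * K) * (1 - \<alpha> * K)"
    assume *: "A N * U (N + 2) (Suc k) = (A N + C N) * U (N + 1) (Suc k) - C N * U N (Suc k)
      - U (N + 1) k / p * ?E"
    have "U (N + 1) k / D k / p = U (N + 1) k / p * ?E / (D k * ?E)"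
      using nz by simp
    then show ?thesis
      unfolding W D_Suc by (simp only: times_divide_eq_right * flip: diff_divide_distrib)
  qed
qed

text \<open>By the three-term recurrence, the imaginary part of \<open>W (N + 1) x * cnj (W N x)\<close> keeps the
  sign opposite to that of \<open>Im x\<close>, so that no Wall polynomial vanishes off the real line.\<close>

lemma wall_poly_real_zeros:
  assumes p: "0 < p" "p < 1" and \<alpha>: "0 < \<alpha>" "\<alpha> < 1"
    and root: "(\<Sum>k\<le>N. of_real (wall_coeff p \<alpha> N k) * x ^ k) = (0::complex)"
  shows "x \<in> \<real>"
proof -
  define A where "A = (\<lambda>N. p ^ Suc N * (1 - \<alpha> * p ^ Suc N))"
  define C where "C = (\<lambda>N. \<alpha> * p ^ N * (1 - p ^ Suc N))"
  define W where "W = (\<lambda>N. \<Sum>k\<le>N. of_real (wall_coeff p \<alpha> N k) * x ^ k)"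
  have pj: "p ^ Suc j < 1" "\<alpha> * p ^ j < 1" for j
    using p \<alpha> power_Suc_less_one[of p j] mult_less_le_imp_less[of \<alpha> 1 "p ^ j" 1]
    by (auto simp: power_le_one)
  have A: "0 < A N" and C: "0 < C N" for N
    unfolding A_def C_def using p \<alpha> pj(1)[of N] pj(2)[of "Suc N"] by (auto intro!: mult_pos_pos)
  \<comment> \<open>Coefficients beyond the degree vanish, so the three polynomials can be summed
    over a common range.\<close>
  have W_ext: "W N = (\<Sum>k\<le>M. of_real (wall_coeff p \<alpha> N k) * x ^ k)" if "N \<le> M" for N M
    unfolding W_def using that p by (intro sum.mono_neutral_left) (auto simp: wall_coeff_eq_0)
  have rec: "of_real (A N) * W (N + 2) =
      of_real (A N + C N) * W (N + 1) - of_real (C N) * W N - x / of_real p * W (N + 1)" for N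
  proof -
    let ?w = "\<lambda>M k. complex_of_real (wall_coeff p \<alpha> M k)"
    have split: "W M = ?w M 0 + (\<Sum>k\<le>N + 1. ?w M (Suc k) * (x * x ^ k))" if "M \<le> N + 2" for M
    proof -
      have "W M = (\<Sum>k\<le>Suc (N + 1). ?w M k * x ^ k)"
        using W_ext[of M "N + 2"] that by simp
      then show ?thesis
        by (simp only: sum.atMost_Suc_shift power_0 mult_1_right power_Suc)
    qed
    have rec0: "of_real (A N) * ?w (N + 2) 0 =
        of_real (A N + C N) * ?w (N + 1) 0 - of_real (C N) * ?w N 0"
    proof -
      have "A N * wall_coeff p \<alpha> (N + 2) 0 =
          (A N + C N) * wall_coeff p \<alpha> (N + 1) 0 - C N * wall_coeff p \<alpha> N 0"
        unfolding A_def C_def by (rule wall_coeff_recurrence(1)[OF p \<alpha>])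
      then show ?thesis
        by (simp only: flip: of_real_mult of_real_diff)
    qed
    have recS: "of_real (A N) * ?w (N + 2) (Suc k) = of_real (A N + C N) * ?w (N + 1) (Suc k)
        - of_real (C N) * ?w N (Suc k) - ?w (N + 1) k / of_real p" for k
    proof -
      have "A N * wall_coeff p \<alpha> (N + 2) (Suc k) = (A N + C N) * wall_coeff p \<alpha> (N + 1) (Suc k)
          - C N * wall_coeff p \<alpha> N (Suc k) - wall_coeff p \<alpha> (N + 1) k / p"
        unfolding A_def C_def by (rule wall_coeff_recurrence(2)[OF p \<alpha>])
      then show ?thesis
        by (simp only: flip: of_real_mult of_real_diff of_real_divide)
    qed
    define s where "s = (\<lambda>M. \<Sum>k\<le>N + 1. ?w M (Suc k) * (x * x ^ k))"
    have Ws: "W M = ?w M 0 + s M" if "M \<le> N + 2" for M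
      using split[OF that] by (simp only: s_def)
    have "of_real (A N) * s (N + 2) =
        (\<Sum>k\<le>N + 1. of_real (A N) * ?w (N + 2) (Suc k) * (x * x ^ k))"
      by (simp only: s_def sum_distrib_left mult.assoc)
    also have "\<dots> = of_real (A N + C N) * s (N + 1) - of_real (C N) * s N
        - (\<Sum>k\<le>N + 1. ?w (N + 1) k / of_real p * (x * x ^ k))"
      unfolding recS s_def
      by (simp only: left_diff_distrib sum_subtractf sum_distrib_left mult.assoc)
    also have "(\<Sum>k\<le>N + 1. ?w (N + 1) k / of_real p * (x * x ^ k)) = x / of_real p * W (N + 1)"
      by (simp add: W_def sum_distrib_left algebra_simps)
    finally have s2: "of_real (A N) * s (N + 2) =
        of_real (A N + C N) * s (N + 1) - of_real (C N) * s N - x / of_real p * W (N + 1)" .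
    have "of_real (A N) * W (N + 2) = of_real (A N) * ?w (N + 2) 0 + of_real (A N) * s (N + 2)"
      using Ws[of "N + 2"] by (simp only: order_refl simp_thms distrib_left)
    also have "\<dots> = of_real (A N + C N) * (?w (N + 1) 0 + s (N + 1))
        - of_real (C N) * (?w N 0 + s N) - x / of_real p * W (N + 1)"
      unfolding rec0 s2 by (simp add: algebra_simps)
    finally show ?thesis
      using Ws[of "N + 1"] Ws[of N] by simp
  qed
  show ?thesis
  proof (rule ccontr)
    assume "x \<notin> \<real>"
    then have im: "Im x \<noteq> 0"
      by (simp add: complex_is_Real_iff)
    have neg: "Im x * Im (W (Suc M) * cnj (W M)) < 0" for M
    proof (induction M)
      case 0
      \<comment> \<open>The product \<open>W 1 * cnj (W 0)\<close> is 1 + c x with this c, so c < 0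
        decides the sign.\<close>
      have "wall_coeff p \<alpha> 1 1 < 0"
      proof -
        have "(1 - 1 / p) / ((1 - p) * (1 - \<alpha>)) < 0"
          using p \<alpha> by (intro divide_neg_pos mult_pos_pos) (auto simp: field_simps)
        then show ?thesis by (simp add: wall_coeff_def)
      qed
      moreover have "W (Suc 0) * cnj (W 0) = 1 + of_real (wall_coeff p \<alpha> 1 1) * x"
        by (simp add: W_def wall_coeff_def)
      ultimately show ?case
        using im by (simp add: mult.left_commute[of "Im x"] mult_less_0_iff zero_less_mult_iff
            flip: power2_eq_square)
    next
      case (Suc M)
      \<comment> \<open>After multiplication by \<open>cnj (W (M + 1))\<close> the term with
        \<open>A M + C M\<close> is real and drops out. \<open>Y\<close> is the conjugate of the
        previous product, so the two surviving imaginary parts do not cancel.\<close>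
      define u where "u = Im (W (Suc M) * cnj (W M))"
      define r where "r = (cmod (W (M + 1)))\<^sup>2"
      define X where "X = W (M + 2) * cnj (W (M + 1))"
      define Y where "Y = W M * cnj (W (M + 1))"
      have "W (M + 1) * cnj (W (M + 1)) = of_real r"
        unfolding r_def by (rule complex_norm_square[symmetric])
      then have "of_real (A M) * X =
          of_real (A M + C M) * of_real r - of_real (C M) * Y - x / of_real p * of_real r"
        using arg_cong[OF rec[of M], of "\<lambda>w. w * cnj (W (M + 1))"]
        by (simp only: left_diff_distrib mult.assoc X_def Y_def)
      then have "Im (of_real (A M) * X) =
          Im (of_real (A M + C M) * of_real r - of_real (C M) * Y - x / of_real p * of_real r)"
        by (rule arg_cong)
      moreover have "Im Y = - u"
        by (simp add: u_def Y_def)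
      ultimately have "A M * Im X = C M * u - Im x / p * r"
        by simp
      then have "Im x * (A M * Im X) = Im x * (C M * u - Im x / p * r)"
        by (rule arg_cong)
      then have "A M * (Im x * Im X) = C M * (Im x * u) - (Im x)\<^sup>2 / p * r"
        by (simp add: algebra_simps power2_eq_square)
      also have "\<dots> < 0"
      proof -
        have "C M * (Im x * u) < 0"
          using Suc C[of M] unfolding u_def by (simp add: mult_less_0_iff)
        moreover have "0 \<le> (Im x)\<^sup>2 / p * r"
          using p by (simp add: r_def)
        ultimately show ?thesis by linarith
      qed
      finally show ?case
        using A[of M] by (simp add: mult_less_0_iff X_def)
    qed
    have "W N \<noteq> 0"
    proof (cases N)
      case 0
      then show ?thesis by (simp add: W_def wall_coeff_def)
    next
      case (Suc M)
      then show ?thesis using neg[of M] by auto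
    qed
    then show False using root by (simp add: W_def)
  qed
qed

section \<open>The q-gamma function and the power series\<close>

lemma summable_prod_powers:
  fixes \<rho> :: "nat \<Rightarrow> real"
  assumes "\<rho> \<longlonglongrightarrow> 0"
  shows "summable (\<lambda>k. (\<Prod>j<k. \<rho> j) * R ^ k)"
proof -
  have "(\<lambda>j. \<bar>\<rho> j * R\<bar>) \<longlonglongrightarrow> 0"
    using tendsto_rabs[OF tendsto_mult_left_zero[OF assms, of R]] by simp
  then have "\<forall>\<^sub>F j in sequentially. \<bar>\<rho> j * R\<bar> < 1 / 2"
    by (rule order_tendstoD) simp
  then obtain N where N: "\<And>j. N \<le> j \<Longrightarrow> \<bar>\<rho> j * R\<bar> \<le> 1 / 2"
    unfolding eventually_sequentially by (meson less_imp_le)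
  show ?thesis
  proof (rule summable_ratio_test[of "1 / 2" N])
    fix k assume "N \<le> k"
    have "norm ((\<Prod>j<Suc k. \<rho> j) * R ^ Suc k) = \<bar>\<rho> k * R\<bar> * norm ((\<Prod>j<k. \<rho> j) * R ^ k)"
      by (simp add: abs_mult)
    also have "\<dots> \<le> 1 / 2 * norm ((\<Prod>j<k. \<rho> j) * R ^ k)"
      using N[OF \<open>N \<le> k\<close>] by (intro mult_right_mono) auto
    finally show "norm ((\<Prod>j<Suc k. \<rho> j) * R ^ Suc k) \<le> 1 / 2 * norm ((\<Prod>j<k. \<rho> j) * R ^ k)" .
  qed simp
qed

lemma higher_deriv_powser_0:
  fixes a :: "nat \<Rightarrow> complex"
  assumes "\<And>z. summable (\<lambda>k. a k * z ^ k)"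
  shows "(deriv ^^ n) (\<lambda>z. \<Sum>k. a k * z ^ k) 0 = fact n * a n"
proof -
  have "fps_conv_radius (Abs_fps a) = \<infinity>"
    unfolding fps_conv_radius_def by (rule conv_radius_inftyI'') (use assms in simp)
  then have "eval_fps (Abs_fps a) has_fps_expansion Abs_fps a"
    by (intro eval_fps_has_fps_expansion) simp
  moreover have "eval_fps (Abs_fps a) = (\<lambda>z. \<Sum>k. a k * z ^ k)"
    by (simp add: eval_fps_def fun_eq_iff)
  ultimately have "a n = (deriv ^^ n) (\<lambda>z. \<Sum>k. a k * z ^ k) 0 / fact n"
    using fps_nth_fps_expansion[of "eval_fps (Abs_fps a)" "Abs_fps a" n] by simp
  then show ?thesis by simp
qed

lemma prod_neg_lessThan: "(\<Prod>j<k::nat. - f j) = (- 1) ^ k * (\<Prod>j<k. f j :: real)"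
  by (induction k) auto

lemma sign_prod_neg: "(- 1) ^ k * (\<Prod>j<k::nat. f j) = (\<Prod>j<k. - f j :: real)"
  by (induction k) auto

text \<open>The approximants are Wall polynomials at \<open>s * p ^ N * z\<close>: the rescaling
  turns 1 - p^j / p^N into p^N - p^j, which tends to - p^j. Truncations are not covered by the
  separation argument here, since \<rho>(j + 1) / \<rho>(j) tends to p, which may exceed
  1/4.\<close>

lemma positive_zeros_limit_wall:
  fixes p \<alpha> s :: real
  assumes p: "0 < p" "p < 1" and \<alpha>: "0 < \<alpha>" "\<alpha> < 1" and s: "0 < s"
  defines "\<rho> \<equiv> \<lambda>j. s * p ^ j / ((1 - p ^ Suc j) * (1 - \<alpha> * p ^ j))"
  assumes \<rho>_lim: "\<rho> \<longlonglongrightarrow> 0"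
  shows "\<exists>n a. positive_zeros_limit (\<lambda>z. \<Sum>k. of_real (\<Prod>j<k. - \<rho> j) * z ^ k) n a"
proof -
  define d where "d = (\<lambda>N k. \<Prod>j<k. s * (p ^ N - p ^ j) / ((1 - p ^ Suc j) * (1 - \<alpha> * p ^ j)))"
  have pj: "p ^ Suc j < 1" "\<alpha> * p ^ j < 1" for j
    using p \<alpha> power_Suc_less_one[of p j] mult_less_le_imp_less[of \<alpha> 1 "p ^ j" 1]
    by (auto simp: power_le_one)
  have den: "0 < (1 - p ^ Suc j) * (1 - \<alpha> * p ^ j)" for j
    using pj by simp
  have \<rho>_pos: "0 < \<rho> j" for j
    unfolding \<rho>_def using s p by (intro divide_pos_pos[OF _ den]) simp
  have d_wall: "d N k = wall_coeff p \<alpha> N k * (s * p ^ N) ^ k" for N k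
  proof -
    have "s * (p ^ N - p ^ j) / ((1 - p ^ Suc j) * (1 - \<alpha> * p ^ j)) =
        (1 - p ^ j / p ^ N) / ((1 - p ^ Suc j) * (1 - \<alpha> * p ^ j)) * (s * p ^ N)" for j
    proof -
      have "s * (p ^ N - p ^ j) = (1 - p ^ j / p ^ N) * (s * p ^ N)"
        using p by (simp add: field_simps)
      then show ?thesis by simp
    qed
    then show ?thesis
      unfolding d_def wall_coeff_def by (simp only: prod.distrib prod_constant card_lessThan power_mult_distrib)
  qed
  have d_zero: "d N k = 0" if "N < k" for N k
    using wall_coeff_eq_0[of p N k \<alpha>] p that by (simp add: d_wall)
  have p_le: "p ^ N \<le> p ^ j" if "j \<le> N" for j N
    using p that by (intro power_decreasing) auto
  show ?thesis
  proof (rule positive_zeros_limit_of_coeffs[of d _ "\<lambda>k. \<Prod>j<k. \<rho> j"])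
    show "d N 0 = 1" for N by (simp add: d_def)
    show "0 \<le> (- 1) ^ k * d N k" for N k
    proof (cases "N < k")
      case False
      have "0 \<le> - (s * (p ^ N - p ^ j) / ((1 - p ^ Suc j) * (1 - \<alpha> * p ^ j)))" if "j < k" for j
      proof -
        have "s * (p ^ N - p ^ j) \<le> 0"
          using p_le[of j N] s False that by (intro mult_nonneg_nonpos) auto
        then show ?thesis
          using den[of j] by (simp add: divide_nonpos_pos)
      qed
      then show ?thesis
        unfolding d_def sign_prod_neg by (intro prod_nonneg) auto
    qed (simp add: d_zero)
    show "z \<in> \<real>" if "(\<Sum>k\<le>N. of_real (d N k) * z ^ k) = (0::complex)" for N z
    proof -
      have "(\<Sum>k\<le>N. of_real (wall_coeff p \<alpha> N k) * (of_real (s * p ^ N) * z) ^ k) =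
          (\<Sum>k\<le>N. of_real (d N k) * z ^ k)"
        by (simp add: d_wall power_mult_distrib mult.assoc)
      then have "of_real (s * p ^ N) * z \<in> \<real>"
        using wall_poly_real_zeros[OF p \<alpha>] that by metis
      then have "of_real (s * p ^ N) * z / of_real (s * p ^ N) \<in> \<real>"
        by (intro Reals_divide) auto
      then show ?thesis using s p by simp
    qed
    show "(\<lambda>N. d N k) \<longlonglongrightarrow> (\<Prod>j<k. - \<rho> j)" for k
    proof -
      have "(\<lambda>N. d N k) \<longlonglongrightarrow>
          (\<Prod>j<k. s * (0 - p ^ j) / ((1 - p ^ Suc j) * (1 - \<alpha> * p ^ j)))"
        unfolding d_def using p less_imp_neq[OF den]
        by (intro tendsto_intros LIMSEQ_realpow_zero) auto
      then show ?thesis by (simp add: \<rho>_def)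
    qed
    show "\<bar>d N k\<bar> \<le> (\<Prod>j<k. \<rho> j)" for N k
    proof (cases "N < k")
      case True
      have "0 \<le> (\<Prod>j<k. \<rho> j)"
        using \<rho>_pos by (intro prod_nonneg) (auto intro: less_imp_le)
      then show ?thesis using True by (simp add: d_zero)
    next
      case False
      have "\<bar>s * (p ^ N - p ^ j) / ((1 - p ^ Suc j) * (1 - \<alpha> * p ^ j))\<bar> \<le> \<rho> j" if "j < k" for j
      proof -
        have "\<bar>p ^ N - p ^ j\<bar> \<le> p ^ j"
          using p_le[of j N] p that False by auto
        then have "s * \<bar>p ^ N - p ^ j\<bar> / ((1 - p ^ Suc j) * (1 - \<alpha> * p ^ j)) \<le> \<rho> j"
          unfolding \<rho>_def using s den[of j] by (intro divide_right_mono mult_left_mono) auto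
        then show ?thesis
          by (simp only: abs_divide abs_mult[of s] abs_of_pos[OF s] abs_of_pos[OF den])
      qed
      then show ?thesis
        unfolding d_def abs_prod by (intro prod_mono) auto
    qed
    show "summable (\<lambda>k. (\<Prod>j<k. \<rho> j) * R ^ k)" for R
      by (intro summable_prod_powers \<rho>_lim)
  qed (use d_zero in auto)
qed

lemma positive_zeros_limit_separated:
  fixes \<rho> :: "nat \<Rightarrow> real"
  assumes pos: "\<And>j. 0 < \<rho> j" and sep: "\<And>j. 4 * \<rho> (Suc j) < \<rho> j" and \<rho>_lim: "\<rho> \<longlonglongrightarrow> 0"
  shows "\<exists>n a. positive_zeros_limit (\<lambda>z. \<Sum>k. of_real (\<Prod>j<k. - \<rho> j) * z ^ k) n a"
proof (rule positive_zeros_limit_of_coeffs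
    [of "\<lambda>N k. if k \<le> N then \<Prod>j<k. - \<rho> j else 0" _ "\<lambda>k. \<Prod>j<k. \<rho> j"])
  have prod_pos: "0 \<le> (\<Prod>j<k. \<rho> j)" for k
    using pos by (intro prod_nonneg) (auto intro: less_imp_le)
  show "0 \<le> (- 1) ^ k * (if k \<le> N then \<Prod>j<k. - \<rho> j else 0)" for N k
    using prod_pos[of k] by (simp add: sign_prod_neg)
  show "\<bar>if k \<le> N then \<Prod>j<k. - \<rho> j else 0\<bar> \<le> (\<Prod>j<k. \<rho> j)" for N k
    using prod_pos[of k] by (simp add: prod_neg_lessThan abs_mult)
  show "(\<lambda>N. if k \<le> N then \<Prod>j<k. - \<rho> j else 0) \<longlonglongrightarrow> (\<Prod>j<k. - \<rho> j)" for k
    by (rule tendsto_eventually, rule eventually_mono[OF eventually_ge_at_top[of k]]) simp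
  show "z \<in> \<real>" if "(\<Sum>k\<le>N. of_real (if k \<le> N then \<Prod>j<k. - \<rho> j else 0) * z ^ k) = (0::complex)" for N z
  proof -
    have "(\<Sum>k\<le>N. of_real (\<Prod>j<k. - \<rho> j) * z ^ k) = 0"
      using that by simp
    then show ?thesis
      by (rule truncation_real_zeros[where \<rho> = \<rho>, OF pos sep])
  qed
qed (use summable_prod_powers[OF \<rho>_lim] in auto)

section \<open>Infinite q-products and the functional equation of the q-gamma function\<close>

lemma convergent_prod_qpochhammer:
  assumes q: "0 < q" "q < 1" and a: "0 < a" "a < (1::real)"
  shows "convergent_prod (\<lambda>k. 1 - a * q ^ k)"
proof -
  have "a * q ^ k < 1" for k
    using q a mult_less_le_imp_less[of a 1 "q ^ k" 1] by (auto simp: power_le_one)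
  moreover have "summable (\<lambda>k. \<bar>- (a * q ^ k)\<bar>)"
    using q a by (simp add: abs_mult summable_mult summable_geometric)
  ultimately show ?thesis
    using summable_imp_convergent_prod_real[of "\<lambda>k. - (a * q ^ k)"] by (simp add: less_imp_neq)
qed

lemma qpochhammer_inf_pos:
  assumes q: "0 < q" "q < 1" and a: "0 < a" "a < 1"
  shows "0 < qpochhammer_inf a q"
proof -
  have "0 < 1 - a * q ^ k" for k
    using q a mult_less_le_imp_less[of a 1 "q ^ k" 1] by (auto simp: power_le_one)
  then show ?thesis
    unfolding qpochhammer_inf_def
    by (intro has_prod_pos[OF convergent_prod_has_prod[OF convergent_prod_qpochhammer[OF q a]]])
qed

lemma qpochhammer_inf_rec:
  assumes q: "0 < q" "q < 1" and a: "0 < a" "a < 1"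
  shows "qpochhammer_inf a q = (1 - a) * qpochhammer_inf (a * q) q"
  using prodinf_split_head[OF convergent_prod_qpochhammer[OF q a]] a
  by (simp add: qpochhammer_inf_def mult.assoc)

lemma q_gamma_pos:
  assumes q: "0 < q" "q < 1" and "0 < x"
  shows "0 < q_gamma q x"
proof -
  have "0 < q powr x" "q powr x < 1"
    using q \<open>0 < x\<close> by (auto simp: powr01_less_one)
  then show ?thesis
    unfolding q_gamma_def using q by (intro mult_pos_pos divide_pos_pos qpochhammer_inf_pos) auto
qed

text \<open>Passing from x to x + 1 removes the head factor \<open>1 - q powr x\<close> from the
  infinite product and lowers the exponent of 1 - q by one.\<close>

lemma q_gamma_plus1:
  assumes q: "0 < q" "q < 1" and "0 < x"
  shows "q_gamma q (x + 1) = (1 - q powr x) / (1 - q) * q_gamma q x"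
proof -
  have x: "0 < q powr x" "q powr x < 1"
    using q \<open>0 < x\<close> by (auto simp: powr01_less_one)
  have xq: "0 < q powr x * q" "q powr x * q < 1"
    using x q mult_strict_mono[of "q powr x" 1 q 1] by auto
  have "q powr (x + 1) = q powr x * q"
    using q by (simp add: powr_add)
  moreover have "(1 - q) powr (1 - (x + 1)) = (1 - q) powr (1 - x) / (1 - q)"
    using q powr_diff[of "1 - q" "1 - x" 1] by simp
  ultimately have "q_gamma q (x + 1) = qpochhammer_inf q q / qpochhammer_inf (q powr x * q) q *
      ((1 - q) powr (1 - x) / (1 - q))"
    by (simp only: q_gamma_def)
  then show ?thesis
    unfolding q_gamma_def[of q x] qpochhammer_inf_rec[OF q x]
    using x(2) by simp
qed

text \<open>Its negative is the quotient of the Taylor coefficients of indices j + 1 and j. The base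
  is q^2 because the q-gamma argument advances by 2.\<close>

definition qE_ratio :: "real \<Rightarrow> real \<Rightarrow> real \<Rightarrow> nat \<Rightarrow> real" where
  "qE_ratio q \<gamma> \<sigma> j = \<sigma>\<^sup>2 * (1 - q)\<^sup>2 * (q\<^sup>2) ^ j /
     ((1 - q powr (\<gamma> + 1) * (q\<^sup>2) ^ j) * (1 - q powr (\<gamma> + 2) * (q\<^sup>2) ^ j))"

section \<open>Taylor coefficients of the normalised entire function\<close>

context
  fixes q \<gamma> \<sigma> :: real
  assumes q: "0 < q" "q < 1" and \<sigma>: "0 < \<sigma>" and \<gamma>: "0 \<le> \<gamma>"
begin

lemma powr_bounds: "0 < q powr (\<gamma> + 1)" "q powr (\<gamma> + 1) < 1" "0 < q powr (\<gamma> + 2)" "q powr (\<gamma> + 2) < 1"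
  using q \<gamma> by (auto simp: powr01_less_one)

lemma qE_ratio_factors:
  assumes "0 < a" "a < 1"
  shows "a * (q\<^sup>2) ^ j \<le> a" "a * (q\<^sup>2) ^ j < 1"
proof -
  have "(q\<^sup>2) ^ j \<le> 1"
    using q by (simp add: power_le_one)
  then show "a * (q\<^sup>2) ^ j \<le> a"
    using assms by (simp add: mult_left_le)
  then show "a * (q\<^sup>2) ^ j < 1" using assms by linarith
qed

lemma qE_ratio_pos: "0 < qE_ratio q \<gamma> \<sigma> j"
  unfolding qE_ratio_def
  using q \<sigma> qE_ratio_factors(2)[of "q powr (\<gamma> + 1)" j] qE_ratio_factors(2)[of "q powr (\<gamma> + 2)" j] powr_bounds
  by (intro divide_pos_pos mult_pos_pos) auto

lemma q_square: "0 < q\<^sup>2" "q\<^sup>2 < 1"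
  using q power_strict_mono[of q 1 2] by auto

lemma qE_ratio_tendsto_0: "qE_ratio q \<gamma> \<sigma> \<longlonglongrightarrow> 0"
proof -
  have "(\<lambda>j. (q\<^sup>2) ^ j) \<longlonglongrightarrow> 0"
    using q_square by (intro LIMSEQ_realpow_zero) auto
  then have "(\<lambda>j. \<sigma>\<^sup>2 * (1 - q)\<^sup>2 * (q\<^sup>2) ^ j /
     ((1 - q powr (\<gamma> + 1) * (q\<^sup>2) ^ j) * (1 - q powr (\<gamma> + 2) * (q\<^sup>2) ^ j))) \<longlonglongrightarrow>
     \<sigma>\<^sup>2 * (1 - q)\<^sup>2 * 0 / ((1 - q powr (\<gamma> + 1) * 0) * (1 - q powr (\<gamma> + 2) * 0))"
    using q_square by (intro tendsto_intros) auto
  then show ?thesis by (simp add: qE_ratio_def[abs_def])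
qed

text \<open>The functional equation of the q-gamma function is applied twice per step, and q^(n (n -
  1)) contributes q^(2 n).\<close>

lemma qE_coeff:
  "q_gamma q (\<gamma> + 1) * ((-1) ^ n * \<sigma> ^ (2 * n) * q ^ (n * (n - 1)) / q_gamma q (2 * real n + \<gamma> + 1)) =
    (\<Prod>j<n. - qE_ratio q \<gamma> \<sigma> j)"
proof (induction n)
  case 0
  then show ?case using q_gamma_pos[OF q, of "\<gamma> + 1"] \<gamma> by simp
next
  case (Suc n)
  define y where "y = 2 * real n + \<gamma> + 1"
  have y: "0 < y" using \<gamma> by (simp add: y_def)
  have qn: "q powr (2 * real n) = (q\<^sup>2) ^ n"
    using q powr_realpow[of q "2 * n"] by (simp add: power_mult)
  have qy: "q powr y = q powr (\<gamma> + 1) * (q\<^sup>2) ^ n" "q powr (y + 1) = q powr (\<gamma> + 2) * (q\<^sup>2) ^ n"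
  proof -
    have "y = 2 * real n + (\<gamma> + 1)" "y + 1 = 2 * real n + (\<gamma> + 2)"
      by (simp_all add: y_def)
    then show "q powr y = q powr (\<gamma> + 1) * (q\<^sup>2) ^ n" "q powr (y + 1) = q powr (\<gamma> + 2) * (q\<^sup>2) ^ n"
      using powr_add[of q "2 * real n" "\<gamma> + 1"] powr_add[of q "2 * real n" "\<gamma> + 2"]
      by (simp_all only: qn mult.commute[of "(q\<^sup>2) ^ n"])
  qed
  have "q_gamma q (2 * real (Suc n) + \<gamma> + 1) = q_gamma q (y + 1 + 1)"
    by (simp add: y_def algebra_simps)
  also have "\<dots> = (1 - q powr (y + 1)) / (1 - q) * ((1 - q powr y) / (1 - q) * q_gamma q y)"
    using q_gamma_plus1[OF q, of y] q_gamma_plus1[OF q, of "y + 1"] y by simp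
  finally have G: "q_gamma q (2 * real (Suc n) + \<gamma> + 1) =
      (1 - q powr (\<gamma> + 2) * (q\<^sup>2) ^ n) * (1 - q powr (\<gamma> + 1) * (q\<^sup>2) ^ n) / (1 - q)\<^sup>2 * q_gamma q y"
    unfolding qy by (simp add: power2_eq_square)
  have "Suc n * (Suc n - 1) = n * (n - 1) + 2 * n"
    by (cases n) auto
  then have pq: "q ^ (Suc n * (Suc n - 1)) = q ^ (n * (n - 1)) * (q\<^sup>2) ^ n"
    by (simp only: power_add power_mult)
  have "q_gamma q (\<gamma> + 1) * ((-1) ^ Suc n * \<sigma> ^ (2 * Suc n) * q ^ (Suc n * (Suc n - 1)) /
        q_gamma q (2 * real (Suc n) + \<gamma> + 1)) =
      q_gamma q (\<gamma> + 1) * ((-1) ^ n * \<sigma> ^ (2 * n) * q ^ (n * (n - 1)) / q_gamma q y) *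
      - qE_ratio q \<gamma> \<sigma> n"
    unfolding G pq qE_ratio_def using q by (simp add: power2_eq_square mult_ac)
  also have "\<dots> = (\<Prod>j<Suc n. - qE_ratio q \<gamma> \<sigma> j)"
    unfolding y_def Suc.IH by simp
  finally show ?case .
qed

lemma qE_powser: "of_real (q_gamma q (\<gamma> + 1)) * qE q \<gamma> \<sigma> z = (\<Sum>k. of_real (\<Prod>j<k. - qE_ratio q \<gamma> \<sigma> j) * z ^ k)"
  and summable_qE_powser: "summable (\<lambda>k. of_real (\<Prod>j<k. - qE_ratio q \<gamma> \<sigma> j) * z ^ k)"
proof -
  have nn: "0 \<le> (\<Prod>j<k. qE_ratio q \<gamma> \<sigma> j)" for k
    using qE_ratio_pos by (intro prod_nonneg) (auto intro: less_imp_le)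
  show *: "summable (\<lambda>k. of_real (\<Prod>j<k. - qE_ratio q \<gamma> \<sigma> j) * z ^ k)"
  proof (rule summable_comparison_test'[OF summable_prod_powers[OF qE_ratio_tendsto_0, of "norm z"], of 0])
    show "norm (of_real (\<Prod>j<k. - qE_ratio q \<gamma> \<sigma> j) * z ^ k) \<le> (\<Prod>j<k. qE_ratio q \<gamma> \<sigma> j) * norm z ^ k" for k
      using nn[of k] unfolding norm_mult norm_power norm_of_real prod_neg_lessThan abs_mult by simp
  qed
  define G where "G = q_gamma q (\<gamma> + 1)"
  have "0 < G"
    using q_gamma_pos[OF q] \<gamma> by (simp add: G_def)
  define t where "t = (\<lambda>k. complex_of_real
    ((-1) ^ k * \<sigma> ^ (2 * k) * q ^ (k * (k - 1)) / q_gamma q (2 * real k + \<gamma> + 1)) * z ^ k)"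
  have t: "of_real (\<Prod>j<k. - qE_ratio q \<gamma> \<sigma> j) * z ^ k = of_real G * t k" for k
    unfolding t_def G_def mult.assoc[symmetric] of_real_mult[symmetric] qE_coeff ..
  have "summable t"
    using * \<open>0 < G\<close> unfolding t by (simp add: summable_cmult_iff)
  then show "of_real (q_gamma q (\<gamma> + 1)) * qE q \<gamma> \<sigma> z = (\<Sum>k. of_real (\<Prod>j<k. - qE_ratio q \<gamma> \<sigma> j) * z ^ k)"
    unfolding t by (subst suminf_mult) (auto simp: qE_def t_def G_def)
qed

lemma positive_zeros_limit_qE:
  assumes "\<gamma> \<in> {0, 1} \<or> inverse q * (1 - q) * (1 - q powr (\<gamma> + 1)) * (1 - q powr (\<gamma> + 2)) > 1"
  shows "\<exists>n a. positive_zeros_limit (\<lambda>z. of_real (q_gamma q (\<gamma> + 1)) * qE q \<gamma> \<sigma> z) n a"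
proof -
  note q2 = q_square
  have s: "0 < \<sigma>\<^sup>2 * (1 - q)\<^sup>2"
    using q \<sigma> by simp
  have "\<exists>n a. positive_zeros_limit (\<lambda>z. \<Sum>k. of_real (\<Prod>j<k. - qE_ratio q \<gamma> \<sigma> j) * z ^ k) n a"
  proof (cases "\<gamma> \<in> {0, 1}")
    case True
    \<comment> \<open>One factor of the denominator must be 1 - (q^2)^(j + 1). For \<gamma> = 0 it
      is the one with \<open>\<gamma> + 2\<close>, leaving \<alpha> = q; for \<gamma> = 1 the one
      with \<open>\<gamma> + 1\<close>, leaving \<alpha> = q^3.\<close>
    have "\<exists>\<alpha>. 0 < \<alpha> \<and> \<alpha> < 1 \<and> qE_ratio q \<gamma> \<sigma> =
        (\<lambda>j. \<sigma>\<^sup>2 * (1 - q)\<^sup>2 * (q\<^sup>2) ^ j / ((1 - (q\<^sup>2) ^ Suc j) * (1 - \<alpha> * (q\<^sup>2) ^ j)))"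
    proof (cases "\<gamma> = 0")
      case True
      then show ?thesis
        using q by (intro exI[of _ q]) (auto simp: qE_ratio_def fun_eq_iff mult_ac)
    next
      case False
      then have "\<gamma> = 1"
        using \<open>\<gamma> \<in> {0, 1}\<close> by simp
      moreover have "q ^ 3 < 1"
        using q power_strict_mono[of q 1 3] by simp
      ultimately show ?thesis
        using q by (intro exI[of _ "q ^ 3"]) (auto simp: qE_ratio_def fun_eq_iff)
    qed
    then obtain \<alpha> where \<alpha>: "0 < \<alpha>" "\<alpha> < 1" and eq: "qE_ratio q \<gamma> \<sigma> =
        (\<lambda>j. \<sigma>\<^sup>2 * (1 - q)\<^sup>2 * (q\<^sup>2) ^ j / ((1 - (q\<^sup>2) ^ Suc j) * (1 - \<alpha> * (q\<^sup>2) ^ j)))"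
      by blast
    show ?thesis
      using positive_zeros_limit_wall[OF q2 \<alpha> s] qE_ratio_tendsto_0 unfolding eq by blast
  next
    case False
    \<comment> \<open>The last two factors are below 1, so the hypothesis yields q < 1 - q.\<close>
    have "(1 - q) * ((1 - q powr (\<gamma> + 1)) * (1 - q powr (\<gamma> + 2))) \<le> (1 - q) * (1 * 1)"
      using powr_bounds q by (intro mult_left_mono mult_mono) auto
    moreover have "q < (1 - q) * ((1 - q powr (\<gamma> + 1)) * (1 - q powr (\<gamma> + 2)))"
      using assms False q by (simp add: field_simps)
    ultimately have "q < 1 / 2" by simp
    then have "q\<^sup>2 < (1 / 2)\<^sup>2"
      using q by (intro power_strict_mono) auto
    then have q4: "4 * q\<^sup>2 < 1" by (simp add: power2_eq_square)
    show ?thesis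
    proof (rule positive_zeros_limit_separated[OF qE_ratio_pos _ qE_ratio_tendsto_0])
      fix j
      \<comment> \<open>The denominators grow with j, so each ratio is at most q^2 < 1/4 times its
        predecessor.\<close>
      have le: "1 - a * (q\<^sup>2) ^ j \<le> 1 - a * (q\<^sup>2) ^ Suc j" if "0 < a" for a
        using q2 that by (auto simp: mult_left_le_one_le)
      have "qE_ratio q \<gamma> \<sigma> (Suc j) \<le> \<sigma>\<^sup>2 * (1 - q)\<^sup>2 * (q\<^sup>2) ^ Suc j /
          ((1 - q powr (\<gamma> + 1) * (q\<^sup>2) ^ j) * (1 - q powr (\<gamma> + 2) * (q\<^sup>2) ^ j))"
        unfolding qE_ratio_def
        using powr_bounds qE_ratio_factors(2)[of "q powr (\<gamma> + 1)"]
          qE_ratio_factors(2)[of "q powr (\<gamma> + 2)"] s q2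
        by (intro divide_left_mono mult_mono le mult_pos_pos mult_nonneg_nonneg) (auto intro: less_imp_le simp del: power_Suc)
      also have "\<dots> = q\<^sup>2 * qE_ratio q \<gamma> \<sigma> j"
        by (simp add: qE_ratio_def)
      finally have "4 * qE_ratio q \<gamma> \<sigma> (Suc j) \<le> 4 * q\<^sup>2 * qE_ratio q \<gamma> \<sigma> j"
        by simp
      also have "\<dots> < 1 * qE_ratio q \<gamma> \<sigma> j"
        using q4 qE_ratio_pos by (intro mult_strict_right_mono)
      finally show "4 * qE_ratio q \<gamma> \<sigma> (Suc j) < qE_ratio q \<gamma> \<sigma> j" by simp
    qed
  qed
  then show ?thesis unfolding qE_powser .
qed

lemma higher_deriv_qE:
  "(deriv ^^ n) (\<lambda>z. of_real (q_gamma q (\<gamma> + 1)) * qE q \<gamma> \<sigma> z) 0 =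
    of_real (fact n * (q_gamma q (\<gamma> + 1) *
      ((-1) ^ n * \<sigma> ^ (2 * n) * q ^ (n * (n - 1)) / q_gamma q (2 * real n + \<gamma> + 1))))"
  unfolding qE_powser qE_coeff by (subst higher_deriv_powser_0[OF summable_qE_powser]) simp

end

section \<open>Radii of starlikeness\<close>

text \<open>One boundary point suffices, because every larger admissible disk contains the real
  point r.\<close>

lemma radius_of_starlikeness_eq:
  assumes r: "0 < r" "ball 0 r \<subseteq> D"
    and inside: "\<And>z. z \<in> ball 0 r - {0} \<Longrightarrow> f z \<noteq> 0 \<and> 0 < Re (z * deriv f z / f z)"
    and boundary: "complex_of_real r \<in> D \<Longrightarrow> Re (of_real r * deriv f (of_real r) / f (of_real r)) \<le> 0"
  shows "radius_of_starlikeness D f = ereal r"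
  unfolding radius_of_starlikeness_def
proof (rule antisym)
  show "Sup {ereal r |r. 0 < r \<and> ball 0 r \<subseteq> D \<and>
      (\<forall>z\<in>ball 0 r - {0}. f z \<noteq> 0 \<and> Re (z * deriv f z / f z) > 0)} \<le> ereal r"
  proof (rule Sup_least, safe)
    fix s assume s: "0 < s" "ball 0 s \<subseteq> D"
      "\<forall>z\<in>ball 0 s - {0}. f z \<noteq> 0 \<and> Re (z * deriv f z / f z) > 0"
    have "\<not> r < s"
    proof
      assume "r < s"
      then have "of_real r \<in> ball (0::complex) s - {0}"
        using r by simp
      then have "of_real r \<in> D" "0 < Re (of_real r * deriv f (of_real r) / f (of_real r))"
        using s by blast+
      then show False using boundary by simp
    qed
    then show "ereal s \<le> ereal r" by simp
  qed
  show "ereal r \<le> Sup {ereal r |r. 0 < r \<and> ball 0 r \<subseteq> D \<and>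
      (\<forall>z\<in>ball 0 r - {0}. f z \<noteq> 0 \<and> Re (z * deriv f z / f z) > 0)}"
    by (rule Sup_upper) (use r inside in blast)
qed

context positive_zeros_limit
begin

text \<open>The pair (t, m) is (1, 1) for h, (1/2, 2) for g and ((\<gamma> + 1)/2, 2) for f. At z =
  r the real part is exactly 1 - t / t = 0.\<close>

lemma radius_of_starlikeness_power:
  assumes t: "0 < t" and x: "0 < r" "F (of_real (r ^ m)) \<noteq> 0" "Re (S (of_real (r ^ m))) = t"
    and m: "0 < m"
    and nz: "\<And>z. norm z < r ^ m \<Longrightarrow> F z \<noteq> 0" and S_less: "\<And>z. norm z < r ^ m \<Longrightarrow> Re (S z) < t"
    and D: "ball 0 r \<subseteq> D"
    and f: "\<And>z. z \<in> D \<Longrightarrow> z \<noteq> 0 \<Longrightarrow> F (z ^ m) \<noteq> 0 \<Longrightarrow>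
      f z \<noteq> 0 \<and> z * deriv f z / f z = 1 - S (z ^ m) / of_real t"
  shows "radius_of_starlikeness D f = ereal r"
proof (rule radius_of_starlikeness_eq[OF x(1) D])
  fix z :: complex assume z: "z \<in> ball 0 r - {0}"
  then have "norm (z ^ m) < r ^ m"
    using m by (auto simp: norm_power intro!: power_strict_mono)
  then have "F (z ^ m) \<noteq> 0" "Re (S (z ^ m)) < t"
    using nz S_less by auto
  moreover have "z \<in> D" "z \<noteq> 0"
    using z D by auto
  ultimately show "f z \<noteq> 0 \<and> 0 < Re (z * deriv f z / f z)"
    using f[of z] t by (simp add: Re_divide_of_real)
next
  assume "complex_of_real r \<in> D"
  then show "Re (of_real r * deriv f (of_real r) / f (of_real r)) \<le> 0"
    using f[of "of_real r"] x t by (simp add: Re_divide_of_real)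
qed

section \<open>Logarithmic derivatives of the three normalised functions\<close>

lemma deriv_id_times_F: "F z \<noteq> 0 \<Longrightarrow> z \<noteq> 0 \<Longrightarrow>
    z * F z \<noteq> 0 \<and> z * deriv (\<lambda>z. z * F z) z / (z * F z) = 1 - S z"
proof -
  assume nz: "F z \<noteq> 0" "z \<noteq> 0"
  have "((\<lambda>z. z * F z) has_field_derivative F z + z * deriv F z) (at z)"
    by (auto intro!: derivative_eq_intros has_field_derivative_F)
  then show ?thesis
    using nz by (simp add: DERIV_imp_deriv S_def add_divide_distrib)
qed

lemma has_field_derivative_F_square:
  "((\<lambda>z. F (z\<^sup>2)) has_field_derivative 2 * z * deriv F (z\<^sup>2)) (at z)"
  by (rule DERIV_chain'[OF _ has_field_derivative_F, THEN DERIV_cong])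
    (auto intro!: derivative_eq_intros)

lemma deriv_id_times_F_square: "F (z\<^sup>2) \<noteq> 0 \<Longrightarrow> z \<noteq> 0 \<Longrightarrow>
    z * F (z\<^sup>2) \<noteq> 0 \<and> z * deriv (\<lambda>z. z * F (z\<^sup>2)) z / (z * F (z\<^sup>2)) = 1 - 2 * S (z\<^sup>2)"
proof -
  assume nz: "F (z\<^sup>2) \<noteq> 0" "z \<noteq> 0"
  have "((\<lambda>z. z * F (z\<^sup>2)) has_field_derivative F (z\<^sup>2) + z * (2 * z * deriv F (z\<^sup>2))) (at z)"
    by (auto intro!: derivative_eq_intros has_field_derivative_F_square)
  then show ?thesis
    using nz by (simp add: DERIV_imp_deriv S_def add_divide_distrib power2_eq_square)
qed

text \<open>Differentiating exp (L z) = F(z^2) determines L' without reference to the branch, so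
  only the exponent enters. For \<beta> = 1 / (\<gamma> + 1) the factor 2 \<beta> is 1 / t with t =
  (\<gamma> + 1) / 2.\<close>

lemma deriv_power_branch:
  fixes \<beta> :: real
  assumes D: "open D" "convex D" "0 \<in> D" and nz: "\<And>z. z \<in> D \<Longrightarrow> F (z\<^sup>2) \<noteq> 0" and z: "z \<in> D" "z \<noteq> 0"
  defines "w \<equiv> power_branch D (\<lambda>z. F (z\<^sup>2)) \<beta>"
  shows "z * w z \<noteq> 0 \<and> z * deriv (\<lambda>z. z * w z) z / (z * w z) = 1 - 2 * of_real \<beta> * S (z\<^sup>2)"
proof -
  have "(\<lambda>z. F (z\<^sup>2)) holomorphic_on D"
    using has_field_derivative_F_square
    by (meson DERIV_subset holomorphic_on_def field_differentiable_def subset_UNIV)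
  then have "is_power_branch D (\<lambda>z. F (z\<^sup>2)) \<beta> w"
    unfolding w_def using F_0 by (intro is_power_branch_power_branch D nz) auto
  then obtain L where L: "L holomorphic_on D" "\<And>z. z \<in> D \<Longrightarrow> exp (L z) = F (z\<^sup>2)"
      "\<And>z. z \<in> D \<Longrightarrow> w z = exp (of_real \<beta> * L z)"
    unfolding is_power_branch_def by blast
  have dL: "(L has_field_derivative deriv L z) (at z)"
    using holomorphic_derivI[OF L(1) D(1) z(1)] .
  have "((\<lambda>z. exp (L z)) has_field_derivative exp (L z) * deriv L z) (at z)"
    by (auto intro!: derivative_eq_intros dL)
  moreover have "((\<lambda>z. exp (L z)) has_field_derivative 2 * z * deriv F (z\<^sup>2)) (at z)"
    by (rule has_field_derivative_transform_within_open[OF has_field_derivative_F_square D(1) z(1)])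
      (simp add: L(2))
  ultimately have "F (z\<^sup>2) * deriv L z = 2 * z * deriv F (z\<^sup>2)"
    using L(2)[OF z(1)] DERIV_unique by metis
  then have L': "deriv L z = 2 * z * deriv F (z\<^sup>2) / F (z\<^sup>2)"
    using nz[OF z(1)] by (simp add: field_simps)
  have "((\<lambda>z. z * exp (of_real \<beta> * L z)) has_field_derivative
      exp (of_real \<beta> * L z) + z * (exp (of_real \<beta> * L z) * (of_real \<beta> * deriv L z))) (at z)"
    by (auto intro!: derivative_eq_intros dL)
  then have "((\<lambda>z. z * w z) has_field_derivative w z + z * (w z * (of_real \<beta> * deriv L z))) (at z)"
    unfolding L(3)[OF z(1)]
    by (rule has_field_derivative_transform_within_open[OF _ D(1) z(1)]) (simp add: L(3))
  then have "deriv (\<lambda>z. z * w z) z = w z * (1 + of_real \<beta> * (z * deriv L z))"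
    by (simp add: DERIV_imp_deriv algebra_simps)
  moreover have "w z \<noteq> 0"
    by (simp add: L(3)[OF z(1)])
  ultimately have "z * deriv (\<lambda>z. z * w z) z / (z * w z) = 1 + of_real \<beta> * (z * deriv L z)"
    using z by simp
  also have "\<dots> = 1 - 2 * of_real \<beta> * S (z\<^sup>2)"
    by (simp add: L' S_def power2_eq_square)
  finally show ?thesis using \<open>w z \<noteq> 0\<close> z by simp
qed

end

lemma zero_free_disk_nonzero: "z \<in> zero_free_disk q \<gamma> \<sigma> \<Longrightarrow> qE q \<gamma> \<sigma> (z\<^sup>2) \<noteq> 0"
  unfolding zero_free_disk_def zero_free_radius_def by (auto simp: less_Sup_iff)

lemma ball_subset_zero_free_disk:
  assumes "0 < r" "\<And>z. z \<in> ball 0 r \<Longrightarrow> qE q \<gamma> \<sigma> (z\<^sup>2) \<noteq> 0"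
  shows "ball 0 r \<subseteq> zero_free_disk q \<gamma> \<sigma>"
  unfolding zero_free_disk_def zero_free_radius_def
  by (intro ball_eball_mono Sup_upper) (use assms in blast)

lemma convex_zero_free_disk: "convex (zero_free_disk q \<gamma> \<sigma>)"
  unfolding zero_free_disk_def by (cases "zero_free_radius q \<gamma> \<sigma>") auto

section \<open>Evaluation of the three radii\<close>

theorem theorem1p2:
  fixes q \<gamma> \<sigma> :: real
  assumes "0 < q" "q < 1" and "0 < \<sigma>" and "0 \<le> \<gamma>" "\<gamma> < 2"
    and "\<gamma> \<in> {0, 1} \<or>
         \<gamma> \<in> {0<..<2} - {1} \<and>
           inverse q * (1 - q) * (1 - q powr (\<gamma> + 1)) * (1 - q powr (\<gamma> + 2)) > 1"
  defines "G \<equiv> q_gamma q"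
  defines "rf \<equiv> radius_of_starlikeness (zero_free_disk q \<gamma> \<sigma>) (fE q \<gamma> \<sigma>)"
    and "rg \<equiv> radius_of_starlikeness UNIV (gE q \<gamma> \<sigma>)"
    and "rh \<equiv> radius_of_starlikeness UNIV (hE q \<gamma> \<sigma>)"
  shows
    "(ereal (\<sigma>\<^sup>2 * (\<gamma> + 3) * G (\<gamma> + 1) / ((\<gamma> + 1) * G (\<gamma> + 3))
             - 2 * \<sigma>\<^sup>2 * q\<^sup>2 * (\<gamma> + 5) * G (\<gamma> + 3) / ((\<gamma> + 3) * G (\<gamma> + 5)))
        < inverse (rf\<^sup>2)
      \<and> inverse (rf\<^sup>2)
        < ereal (\<sigma>\<^sup>2 * (\<gamma> + 3) * G (\<gamma> + 1) / ((\<gamma> + 1) * G (\<gamma> + 3))))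
     \<and>
     (ereal (G (\<gamma> + 3) / (3 * \<sigma>\<^sup>2 * G (\<gamma> + 1))) < rg\<^sup>2
      \<and> rg\<^sup>2
        < ereal (3 * G (\<gamma> + 3) * G (\<gamma> + 5)
             / (\<sigma>\<^sup>2 * (9 * G (\<gamma> + 1) * G (\<gamma> + 5) - 10 * q\<^sup>2 * (G (\<gamma> + 3))\<^sup>2))))
     \<and>
     (ereal (G (\<gamma> + 3) / (2 * \<sigma>\<^sup>2 * G (\<gamma> + 1))) < rh
      \<and> rh
        < ereal (G (\<gamma> + 3) * G (\<gamma> + 5)
             / (\<sigma>\<^sup>2 * (2 * G (\<gamma> + 1) * G (\<gamma> + 5) - 3 * q\<^sup>2 * (G (\<gamma> + 3))\<^sup>2))))"
proof -
  note q = \<open>0 < q\<close> \<open>q < 1\<close> and \<sigma> = \<open>0 < \<sigma>\<close> and \<gamma> = \<open>0 \<le> \<gamma>\<close>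
  define F where "F = (\<lambda>z. of_real (q_gamma q (\<gamma> + 1)) * qE q \<gamma> \<sigma> z)"
  have "\<exists>n a. positive_zeros_limit F n a"
    unfolding F_def using assms(6) by (intro positive_zeros_limit_qE[OF q \<sigma> \<gamma>]) blast
  then obtain n a where "positive_zeros_limit F n a"
    by blast
  then interpret positive_zeros_limit F n a .
  define G1 G3 G5 where "G1 = G (\<gamma> + 1)" and "G3 = G (\<gamma> + 3)" and "G5 = G (\<gamma> + 5)"
  have G: "0 < G1" "0 < G3" "0 < G5"
    using q_gamma_pos[OF q] \<gamma> by (auto simp: G1_def G3_def G5_def G_def)
  have "deriv F 0 = of_real (- (\<sigma>\<^sup>2 * G1 / G3))"
    using higher_deriv_qE[OF q \<sigma> \<gamma>, of 1]
    by (simp add: F_def G1_def G3_def G_def add.commute power2_eq_square)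
  then have c1: "c1 = \<sigma>\<^sup>2 * G1 / G3"
    by (simp add: c1_def)
  have "(deriv ^^ 2) F 0 = of_real (2 * (\<sigma> ^ 4 * q\<^sup>2 * G1 / G5))"
    using higher_deriv_qE[OF q \<sigma> \<gamma>, of 2]
    by (simp add: F_def G1_def G5_def G_def add.commute power2_eq_square)
  then have c2: "c2 = \<sigma> ^ 4 * q\<^sup>2 * G1 / G5"
    by (simp add: c2_def)
  have pos: "0 < c1" "0 < c2"
    using G \<sigma> q by (auto simp: c1 c2)
  have ratio: "c2 / c1 = \<sigma>\<^sup>2 * q\<^sup>2 * G3 / G5"
    unfolding c1 c2 using G \<sigma> by (simp add: field_simps flip: power_add)
  \<comment> \<open>This makes 3 c1 - (10/3) c2 / c1 and 2 c1 - 3 c2 / c1 positive, so that the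
    bounds for \<open>1 / y\<close> and \<open>1 / x\<close> can be inverted.\<close>
  have c2_le: "2 * (c2 / c1) \<le> c1"
    using c1_square_ge pos by (simp add: field_simps power2_eq_square)

  obtain x where x: "0 < x" "F (of_real x) \<noteq> 0" "Re (S (of_real x)) = 1"
      "\<And>z. norm z < x \<Longrightarrow> F z \<noteq> 0" "\<And>z. norm z < x \<Longrightarrow> Re (S z) < 1"
      "1 / x < (1 + 1 / 1) * c1" "(1 + 1 / 1) * c1 - 2 * (1 + 2) / (1 + 1) * (c2 / c1) < 1 / x"
    using exists_starlike_root[OF zero_less_one pos] by blast
  have hE: "hE q \<gamma> \<sigma> = (\<lambda>z. z * F z)"
    by (simp add: hE_def F_def fun_eq_iff)
  have rh: "rh = ereal x"
    unfolding rh_def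
  proof (rule radius_of_starlikeness_power[where t = 1 and m = 1])
    fix z :: complex assume "z \<noteq> 0" "F (z ^ 1) \<noteq> 0"
    then show "hE q \<gamma> \<sigma> z \<noteq> 0 \<and> z * deriv (hE q \<gamma> \<sigma>) z / hE q \<gamma> \<sigma> z = 1 - S (z ^ 1) / of_real 1"
      unfolding hE using deriv_id_times_F[of z] by simp
  qed (use x in auto)

  have half: "0 < (1 / 2 :: real)" by simp
  obtain y where y: "0 < y" "F (of_real y) \<noteq> 0" "Re (S (of_real y)) = 1 / 2"
      "\<And>z. norm z < y \<Longrightarrow> F z \<noteq> 0" "\<And>z. norm z < y \<Longrightarrow> Re (S z) < 1 / 2"
      "1 / y < (1 + 1 / (1 / 2)) * c1"
      "(1 + 1 / (1 / 2)) * c1 - 2 * (1 / 2 + 2) / (1 / 2 + 1) * (c2 / c1) < 1 / y"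
    using exists_starlike_root[OF half pos] by blast
  have gE: "gE q \<gamma> \<sigma> = (\<lambda>z. z * F (z\<^sup>2))"
    by (simp add: gE_def F_def fun_eq_iff)
  have sq: "sqrt y ^ 2 = y"
    using y by simp
  have rg: "rg = ereal (sqrt y)"
    unfolding rg_def
  proof (rule radius_of_starlikeness_power[where t = "1 / 2" and m = 2])
    fix z :: complex assume "z \<noteq> 0" "F (z ^ 2) \<noteq> 0"
    then show "gE q \<gamma> \<sigma> z \<noteq> 0 \<and> z * deriv (gE q \<gamma> \<sigma>) z / gE q \<gamma> \<sigma> z = 1 - S (z ^ 2) / of_real (1 / 2)"
      unfolding gE using deriv_id_times_F_square[of z] by simp
  qed (use y sq in auto)

  define t where "t = (\<gamma> + 1) / 2"
  have t: "0 < t" using \<gamma> by (simp add: t_def)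
  obtain w where w: "0 < w" "F (of_real w) \<noteq> 0" "Re (S (of_real w)) = t"
      "\<And>z. norm z < w \<Longrightarrow> F z \<noteq> 0" "\<And>z. norm z < w \<Longrightarrow> Re (S z) < t"
      "1 / w < (1 + 1 / t) * c1"
      "(1 + 1 / t) * c1 - 2 * (t + 2) / (t + 1) * (c2 / c1) < 1 / w"
    using exists_starlike_root[OF t pos] by blast
  have sqw: "sqrt w ^ 2 = w"
    using w by simp
  define D where "D = zero_free_disk q \<gamma> \<sigma>"
  \<comment> \<open>This also gives \<open>0 \<in> D\<close>, as the power branch requires.\<close>
  have ballD: "ball 0 (sqrt w) \<subseteq> D"
    unfolding D_def
  proof (rule ball_subset_zero_free_disk)
    fix z :: complex assume "z \<in> ball 0 (sqrt w)"
    then have "norm z ^ 2 < sqrt w ^ 2"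
      by (intro power_strict_mono) auto
    then have "F (z\<^sup>2) \<noteq> 0"
      using w(4)[of "z\<^sup>2"] sqw by (simp add: norm_power)
    then show "qE q \<gamma> \<sigma> (z\<^sup>2) \<noteq> 0" by (simp add: F_def)
  qed (use w in simp)
  have D: "open D" "convex D" "0 \<in> D"
  proof -
    show "open D" by (simp add: D_def zero_free_disk_def open_eball)
    show "convex D" by (simp add: D_def convex_zero_free_disk)
    have "(0::complex) \<in> ball 0 (sqrt w)" using w by simp
    then show "0 \<in> D" using ballD by blast
  qed
  have fE: "fE q \<gamma> \<sigma> = (\<lambda>z. z * power_branch D (\<lambda>z. F (z\<^sup>2)) (1 / (\<gamma> + 1)) z)"
    by (simp add: fE_def F_def D_def fun_eq_iff)
  have rf: "rf = ereal (sqrt w)"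
    unfolding rf_def D_def[symmetric]
  proof (rule radius_of_starlikeness_power[where t = t and m = 2])
    fix z :: complex assume z: "z \<in> D" "z \<noteq> 0"
    have "F (z\<^sup>2) \<noteq> 0" if "z \<in> D" for z
      using zero_free_disk_nonzero[of z q \<gamma> \<sigma>] that G(1) by (simp add: F_def D_def G1_def G_def)
    from deriv_power_branch[OF D this z, of "1 / (\<gamma> + 1)"] z(2)
    show "fE q \<gamma> \<sigma> z \<noteq> 0 \<and> z * deriv (fE q \<gamma> \<sigma>) z / fE q \<gamma> \<sigma> z = 1 - S (z ^ 2) / of_real t"
      unfolding fE t_def by (simp add: mult.commute)
  qed (use w sqw t ballD in auto)

  have "inverse (rf\<^sup>2) = ereal (1 / w)"
    using w(1) sqw by (simp add: rf power2_eq_square inverse_eq_divide)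
  moreover have "(1 + 1 / t) * c1 = \<sigma>\<^sup>2 * (\<gamma> + 3) * G1 / ((\<gamma> + 1) * G3)"
  proof -
    have "1 + 1 / t = (\<gamma> + 3) / (\<gamma> + 1)"
      using \<gamma> by (simp add: t_def field_simps)
    then show ?thesis by (simp add: c1)
  qed
  moreover have "2 * (t + 2) / (t + 1) * (c2 / c1) = 2 * \<sigma>\<^sup>2 * q\<^sup>2 * (\<gamma> + 5) * G3 / ((\<gamma> + 3) * G5)"
  proof -
    have "2 * (t + 2) / (t + 1) = 2 * (\<gamma> + 5) / (\<gamma> + 3)"
      using \<gamma> by (simp add: t_def field_simps)
    then show ?thesis by (simp add: ratio)
  qed
  ultimately have f: "ereal (\<sigma>\<^sup>2 * (\<gamma> + 3) * G1 / ((\<gamma> + 1) * G3)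
      - 2 * \<sigma>\<^sup>2 * q\<^sup>2 * (\<gamma> + 5) * G3 / ((\<gamma> + 3) * G5)) < inverse (rf\<^sup>2) \<and>
      inverse (rf\<^sup>2) < ereal (\<sigma>\<^sup>2 * (\<gamma> + 3) * G1 / ((\<gamma> + 1) * G3))"
    using w(6,7) by simp

  have "1 / (3 * c1) < y"
    using y(1,6) pos by (simp add: field_simps)
  \<comment> \<open>At t = 1/2 the constants 1 + 1 / t and 2 (t + 2) / (t + 1) are 3 and 10/3; at t
    = 1, used for h, they are 2 and 3.\<close>
  moreover have "y < 1 / (3 * c1 - 10 / 3 * (c2 / c1))"
  proof -
    have "0 < 3 * c1 - 10 / 3 * (c2 / c1)"
      using c2_le pos by linarith
    moreover have "3 * c1 - 10 / 3 * (c2 / c1) < 1 / y"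
      using y(7) by simp
    ultimately show ?thesis
      using y(1) by (simp add: pos_less_divide_eq mult.commute)
  qed
  moreover have "1 / (3 * c1) = G3 / (3 * \<sigma>\<^sup>2 * G1)"
    by (simp add: c1)
  moreover have "1 / (3 * c1 - 10 / 3 * (c2 / c1)) =
      3 * G3 * G5 / (\<sigma>\<^sup>2 * (9 * G1 * G5 - 10 * q\<^sup>2 * G3\<^sup>2))"
  proof -
    have "3 * c1 - 10 / 3 * (c2 / c1) =
        \<sigma>\<^sup>2 * (9 * G1 * G5 - 10 * q\<^sup>2 * G3\<^sup>2) / (3 * G3 * G5)"
      unfolding ratio unfolding c1 using G by (simp add: field_simps power2_eq_square)
    then show ?thesis by simp
  qed
  moreover have "rg\<^sup>2 = ereal y"
    using sq by (simp add: rg power2_eq_square)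
  ultimately have g: "ereal (G3 / (3 * \<sigma>\<^sup>2 * G1)) < rg\<^sup>2 \<and>
      rg\<^sup>2 < ereal (3 * G3 * G5 / (\<sigma>\<^sup>2 * (9 * G1 * G5 - 10 * q\<^sup>2 * G3\<^sup>2)))"
    by simp

  have "1 / (2 * c1) < x"
    using x(1,6) pos by (simp add: field_simps)
  moreover have "x < 1 / (2 * c1 - 3 * (c2 / c1))"
  proof -
    have "0 < 2 * c1 - 3 * (c2 / c1)"
      using c2_le pos by linarith
    moreover have "2 * c1 - 3 * (c2 / c1) < 1 / x"
      using x(7) by simp
    ultimately show ?thesis
      using x(1) by (simp add: pos_less_divide_eq mult.commute)
  qed
  moreover have "1 / (2 * c1) = G3 / (2 * \<sigma>\<^sup>2 * G1)"
    by (simp add: c1)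
  moreover have "1 / (2 * c1 - 3 * (c2 / c1)) =
      G3 * G5 / (\<sigma>\<^sup>2 * (2 * G1 * G5 - 3 * q\<^sup>2 * G3\<^sup>2))"
  proof -
    have "2 * c1 - 3 * (c2 / c1) =
        \<sigma>\<^sup>2 * (2 * G1 * G5 - 3 * q\<^sup>2 * G3\<^sup>2) / (G3 * G5)"
      unfolding ratio unfolding c1 using G by (simp add: field_simps power2_eq_square)
    then show ?thesis by simp
  qed
  ultimately have h: "ereal (G3 / (2 * \<sigma>\<^sup>2 * G1)) < rh \<and>
      rh < ereal (G3 * G5 / (\<sigma>\<^sup>2 * (2 * G1 * G5 - 3 * q\<^sup>2 * G3\<^sup>2)))"
    by (simp add: rh)
  show ?thesis
    using f g h unfolding G1_def G3_def G5_def by blast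
qed

end
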